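(* For $R>0$ let $$\mu(\mathcal{C}_R):= \inf_{u\in C_0^\infty (\mathcal{C}_R\setminus\bigcup_{k\in\mathbb{Z}} \{a_k\}),\ u\neq 0} \frac{\int_{\mathcal{C}_R} |\nabla u|^2 \,dx}{\int_{\mathcal{C}_R} V u^2 \,dx}.$$ Then: (i) For any $R>0$, $$\frac{(d-2)^2}{4\pi R\sqrt{d}\,\coth(\pi R \sqrt{d})}\leq \mu(\mathcal{C}_R) \leq \frac{(d-2)^2}{4}.$$ (ii) Consequently, $$\lim_{R\searrow 0} \mu(\mathcal{C}_R)=\frac{(d-2)^2}{4}.$$
   Context: Let $d\ge 1$ be the dimension and let $h>0$ be fixed by $dh=1$. Set $a_k:=(kh,\ldots,kh)\in\mathbb{R}^d$ for $k\in\mathbb{Z}$ (the singular poles), and define the potential $$V(x)=\sum_{k\in\mathbb{Z}}\frac{1}{|x-a_k|^2},\qquad x\in\mathbb{R}^d\setminus\bigcup_{k\in\mathbb{Z}}\{a_k\}.$$ Let $\gamma=\{(t,\ldots,t):t\in\mathbb{R}\}\subset\mathbb{R}^d$ be the line $x_1=x_2=\cdots=x_d$. For $R>0$, $\mathcal{C}_R$ denotes the (infinite) right circular cylinder of radius $R$ with axis $\gamma$, i.e. the set of points at distance at most $R$ from $\gamma$. $C_0^\infty(\mathcal{C}_R\setminus\bigcup_k\{a_k\})$ denotes the real-valued smooth functions with compact support contained in the interior of $\mathcal{C}_R$ minus the poles. *)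

theory Defs
  imports "HOL-Analysis.Analysis"
begin

text \<open>The ambient space is \<^typ>\<open>real ^ 'n\<close>, so the dimension \<open>d\<close> is \<open>CARD('n)\<close>, automatically \<open>\<ge> 1\<close>.\<close>

definition pole :: "real \<Rightarrow> int \<Rightarrow> real ^ 'n"
  where "pole h k = (\<chi> i. of_int k * h)"

definition poles :: "real \<Rightarrow> (real ^ 'n) set"
  where "poles h = range (pole h)"

text \<open>At a pole one summand is \<open>1 / 0 = 0\<close>. This is harmless: the poles form a null set, and the
  test functions below vanish near them.\<close>

definition potential :: "real \<Rightarrow> real ^ 'n \<Rightarrow> real"
  where "potential h x = (\<Sum>\<^sub>\<infinity>k. 1 / (norm (x - pole h k))\<^sup>2)"

definition diagonal :: "(real ^ 'n) set"
  where "diagonal = range (\<lambda>t. \<chi> i. t)"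

definition cylinder :: "real \<Rightarrow> (real ^ 'n) set"
  where "cylinder R = {x. infdist x diagonal \<le> R}"

definition partial_deriv :: "'n \<Rightarrow> (real ^ 'n \<Rightarrow> real) \<Rightarrow> real ^ 'n \<Rightarrow> real"
  where "partial_deriv i f x = frechet_derivative f (at x) (axis i 1)"

definition gradient :: "(real ^ 'n \<Rightarrow> real) \<Rightarrow> real ^ 'n \<Rightarrow> real ^ 'n"
  where "gradient f x = (\<chi> i. partial_deriv i f x)"

primrec times_cont_diff :: "nat \<Rightarrow> (real ^ 'n \<Rightarrow> real) \<Rightarrow> bool"
  where
    "times_cont_diff 0 f \<longleftrightarrow> continuous_on UNIV f"
  | "times_cont_diff (Suc m) f \<longleftrightarrow>
       (\<forall>x. f differentiable (at x)) \<and> (\<forall>i. times_cont_diff m (partial_deriv i f))"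

definition smooth :: "(real ^ 'n \<Rightarrow> real) \<Rightarrow> bool"
  where "smooth f \<longleftrightarrow> (\<forall>m. times_cont_diff m f)"

text \<open>Smooth functions with compact support in an open set \<open>U\<close>, identified with their extensions
  by zero to the whole space.\<close>

definition test_functions :: "(real ^ 'n) set \<Rightarrow> (real ^ 'n \<Rightarrow> real) set"
  where "test_functions U =
    {u. smooth u \<and> compact (closure {x. u x \<noteq> 0}) \<and> closure {x. u x \<noteq> 0} \<subseteq> U}"

text \<open>When \<open>interior C\<close> is nonempty and \<open>h > 0\<close>, the infimum is over a nonempty set of nonnegative
  reals, so the real-valued \<^const>\<open>Inf\<close> is the genuine infimum.\<close>

definition hardy_const :: "real \<Rightarrow> (real ^ 'n) set \<Rightarrow> real"
  where "hardy_const h C =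
    (INF u \<in> test_functions (interior C - poles h) - {\<lambda>x. 0}.
       (LINT x:C|lborel. (norm (gradient u x))\<^sup>2) / (LINT x:C|lborel. potential h x * (u x)\<^sup>2))"

definition coth :: "real \<Rightarrow> real"
  where "coth x = cosh x / sinh x"

end

theory Submission
  imports Defs "HOL-Real_Asymp.Real_Asymp"
begin

text \<open>
  Write \<open>d\<close> for the dimension, \<open>a\<^sub>k\<close> for the poles, \<open>V\<close> for the potential, \<open>B = R \<surd>d\<close> and
  \<open>Y = \<pi> B coth (\<pi> B)\<close>, so that the lower bound reads \<open>(d - 2)\<^sup>2 / (4 Y)\<close>.

  \<^bold>\<open>Lower bound.\<close> The field \<open>F\<^sub>a x = (x - a) / |x - a|\<^sup>2\<close> has divergence \<open>(d - 2) / |x - a|\<^sup>2\<close>. Integrating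
  \<open>div (u\<^sup>2 F\<^sub>a)\<close> over the space (\<open>hardy_divergence_identity\<close>) and summing over finitely many
  poles, the sum \<open>T\<^sub>N\<close> of the fields of the poles \<open>a\<^sub>k\<close> with \<open>|k| \<le> N\<close> satisfies \<open>\<integral> 2 u \<nabla>u \<bullet> T\<^sub>N = - (d - 2) \<integral> V\<^sub>N u\<^sup>2\<close>, where \<open>V\<^sub>N\<close>
  is the partial sum of \<open>V\<close>. Expanding \<open>0 \<le> \<integral> |\<nabla>u + c u T\<^sub>N|\<^sup>2\<close> and letting \<open>N\<close> tend to infinity gives
  \<open>\<integral> |\<nabla>u|\<^sup>2 \<ge> c (d - 2) \<integral> V u\<^sup>2 - c\<^sup>2 \<integral> |T|\<^sup>2 u\<^sup>2\<close>. In the half plane coordinate \<open>z = \<Sum>\<^sub>i x\<^sub>i + \<i> \<surd>d r\<close>, where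
  \<open>r\<close> is the distance of \<open>x\<close> from the axis, the poles become the integers, \<open>V = d \<Sum>\<^sub>k 1 / |z - k|\<^sup>2\<close>, and
  \<open>|T|\<^sup>2 = d |\<Sum>\<^sub>k 1 / (z - k)|\<^sup>2 = d |\<pi> cot (\<pi> z)|\<^sup>2\<close> by the partial fraction expansion of the cotangent.
  Since \<open>Im (\<pi> cot (\<pi> z)) = - Im z \<Sum>\<^sub>k 1 / |z - k|\<^sup>2\<close>, comparing modulus and imaginary part of the cotangent
  yields \<open>|T|\<^sup>2 \<le> Y V\<close> on the cylinder (\<open>pi_cot_norm_le\<close>). The choice \<open>c = (d - 2) / (2 Y)\<close> finishes the
  argument (\<open>hardy_inequality_cylinder\<close>).

  \<^bold>\<open>Upper bound.\<close> Near the pole at the origin \<open>V \<ge> 1 / |x|\<^sup>2\<close>, and the constant \<open>(d - 2)\<^sup>2 / 4\<close> of the one-pole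
  Hardy inequality is approached by \<open>|x|\<close> to the power \<open>- (d - 2) / 2\<close>, cut off smoothly on the scale of
  \<open>log |x|\<close> (\<open>almost_extremal_energy\<close>). These functions are supported in arbitrarily small punctured
  balls around the origin, hence in every cylinder.

  The limit follows from the two bounds because \<open>t coth t\<close> tends to \<open>1\<close> at \<open>0\<close>.
\<close>

section \<open>Partial fractions of the cotangent\<close>

text \<open>
  The sum over \<open>- N \<le> k \<le> N\<close>. Symmetric partial sums are needed because \<open>\<Sum>\<^sub>k 1 / (z - k)\<close> converges only
  conditionally.
\<close>

definition symm_sum :: "(int \<Rightarrow> 'a::comm_monoid_add) \<Rightarrow> nat \<Rightarrow> 'a"
  where "symm_sum f N = (\<Sum>k\<in>{- int N..int N}. f k)"

lemma symm_sum_Suc: "symm_sum f (Suc N) = symm_sum f N + (f (int (Suc N)) + f (- int (Suc N)))"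
proof -
  have "{- int (Suc N)..int (Suc N)} = insert (int (Suc N)) (insert (- int (Suc N)) {- int N..int N})"
    by auto
  then show ?thesis by (simp add: symm_sum_def add_ac)
qed

lemma symm_sum_eq: "symm_sum f N = f 0 + (\<Sum>n<N. f (int (Suc n)) + f (- int (Suc n)))"
proof (induction N)
  case 0
  show ?case by (simp add: symm_sum_def)
next
  case (Suc N)
  then show ?case by (simp only: symm_sum_Suc sum.lessThan_Suc add.assoc)
qed

lemma finite_int_subset_symm:
  fixes F :: "int set"
  assumes "finite F" shows "\<exists>N. F \<subseteq> {- int N..int N}"
proof -
  obtain M where M: "\<And>k. k \<in> F \<Longrightarrow> nat \<bar>k\<bar> \<le> M"
    using assms finite_nat_set_iff_bounded_le[of "(\<lambda>k. nat \<bar>k\<bar>) ` F"] by auto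
  have "F \<subseteq> {- int M..int M}"
    using M by (force)
  then show ?thesis by blast
qed

lemma symm_sum_tendsto_has_sum:
  fixes f :: "int \<Rightarrow> 'a::{comm_monoid_add,topological_space}"
  assumes "(f has_sum s) UNIV"
  shows "symm_sum f \<longlonglongrightarrow> s"
proof -
  have "filterlim (\<lambda>N. {- int N..int N}) (finite_subsets_at_top UNIV) sequentially"
    unfolding filterlim_finite_subsets_at_top
  proof safe
    fix X :: "int set" assume "finite X"
    then obtain N where N: "X \<subseteq> {- int N..int N}" using finite_int_subset_symm by blast
    show "\<forall>\<^sub>F n in sequentially. finite {- int n..int n} \<and> X \<subseteq> {- int n..int n} \<and> {- int n..int n} \<subseteq> UNIV"
      using eventually_ge_at_top[of N] by eventually_elim (use N in force)
  qed
  with assms show ?thesis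
    unfolding has_sum_def symm_sum_def[abs_def] by (rule filterlim_compose)
qed

lemma summable_on_int_if_symm_sum_bounded:
  fixes f :: "int \<Rightarrow> real"
  assumes nonneg: "\<And>k. f k \<ge> 0" and bound: "\<And>N. symm_sum f N \<le> B"
  shows "f summable_on UNIV"
proof (rule nonneg_bdd_above_summable_on)
  show "bdd_above (sum f ` {F. F \<subseteq> UNIV \<and> finite F})"
  proof (rule bdd_aboveI[where M = B])
    fix s assume "s \<in> sum f ` {F. F \<subseteq> UNIV \<and> finite F}"
    then obtain F where F: "finite F" "s = sum f F" by blast
    then obtain N where "F \<subseteq> {- int N..int N}" using finite_int_subset_symm by blast
    then have "s \<le> symm_sum f N"
      unfolding F symm_sum_def by (intro sum_mono2) (auto simp: nonneg)
    with bound[of N] show "s \<le> B" by simp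
  qed
qed (use nonneg in auto)

text \<open>
  Logarithmic differentiation of the reflection formula for the Gamma function expresses the cotangent
  as a difference of two Digamma values; the logarithms in their limit formulas cancel.
\<close>

lemma pi_cot_partial_fractions:
  fixes z :: complex
  assumes z: "z \<notin> \<int>"
  shows "symm_sum (\<lambda>k. 1 / (z - of_int k)) \<longlonglongrightarrow> of_real pi * cot (of_real pi * z)"
proof -
  have "z \<noteq> of_int k" for k using z by auto
  from this[of 0] this[of "-1"] this[of 1] have nz: "z \<noteq> 0" "1 + z \<noteq> 0" "1 - z \<noteq> 0"
    by (auto simp: add_eq_0_iff)
  have z1: "z \<notin> \<int>\<^sub>\<le>\<^sub>0" "1 - z \<notin> \<int>\<^sub>\<le>\<^sub>0"
    using z nonpos_Ints_subset_Ints Ints_diff[of 1 "1 - z"] by auto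
  have "((\<lambda>z. rGamma z * rGamma (1 - z)) has_field_derivative
      rGamma z * rGamma (1 - z) * (Digamma (1 - z) - Digamma z)) (at z)"
    using z1 by (auto intro!: derivative_eq_intros simp: algebra_simps)
  moreover have "(\<lambda>z. rGamma z * rGamma (1 - z)) = (\<lambda>z::complex. sin (of_real pi * z) / of_real pi)"
    by (simp add: rGamma_reflection_complex)
  moreover have "((\<lambda>z. sin (of_real pi * z) / of_real pi) has_field_derivative cos (of_real pi * z)) (at z)"
    by (auto intro!: derivative_eq_intros)
  ultimately have eq: "sin (of_real pi * z) / of_real pi * (Digamma (1 - z) - Digamma z) = cos (of_real pi * z)"
    by (metis DERIV_unique rGamma_reflection_complex)
  have sin: "sin (of_real pi * z) \<noteq> 0"
    using z1 rGamma_reflection_complex[of z] by (auto simp: rGamma_eq_zero_iff)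
  have cot: "of_real pi * cot (of_real pi * z) = 1 / z + (Digamma (1 - z) - Digamma (1 + z))"
    using eq sin Digamma_plus1[OF nz(1)] by (simp add: cot_def field_simps)
  have "(\<lambda>m. (of_real (ln (real m)) - (\<Sum>n<m. inverse (1 - z + of_nat n)))
      - (of_real (ln (real m)) - (\<Sum>n<m. inverse (1 + z + of_nat n)))) \<longlonglongrightarrow> Digamma (1 - z) - Digamma (1 + z)"
    by (intro tendsto_diff Digamma_LIMSEQ nz)
  then have "(\<lambda>m. 1 / z + ((of_real (ln (real m)) - (\<Sum>n<m. inverse (1 - z + of_nat n)))
      - (of_real (ln (real m)) - (\<Sum>n<m. inverse (1 + z + of_nat n))))) \<longlonglongrightarrow> of_real pi * cot (of_real pi * z)"
    unfolding cot by (intro tendsto_add tendsto_const)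
  moreover have "1 / z + ((of_real (ln (real m)) - (\<Sum>n<m. inverse (1 - z + of_nat n)))
      - (of_real (ln (real m)) - (\<Sum>n<m. inverse (1 + z + of_nat n)))) = symm_sum (\<lambda>k. 1 / (z - of_int k)) m" for m
  proof -
    have "(- inverse (1 - z + of_nat n)) + inverse (1 + z + of_nat n)
      = 1 / (z - of_int (int (Suc n))) + 1 / (z - of_int (- int (Suc n)))" for n
    proof -
      have "- inverse (1 - z + of_nat n) = 1 / (z - of_int (int (Suc n)))"
        using inverse_minus_eq[of "1 - z + of_nat n"] by (simp add: inverse_eq_divide algebra_simps)
      then show ?thesis by (simp add: inverse_eq_divide algebra_simps)
    qed
    then have "(\<Sum>n<m. (- inverse (1 - z + of_nat n)) + inverse (1 + z + of_nat n))
      = (\<Sum>n<m. 1 / (z - of_int (int (Suc n))) + 1 / (z - of_int (- int (Suc n))))"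
      by (intro sum.cong refl) 
    then show ?thesis
      unfolding symm_sum_eq by (simp add: sum.distrib sum_negf sum_subtractf)
  qed
  ultimately show ?thesis by simp
qed

text \<open>
  The partial sums are bounded uniformly on compact sets that avoid the integers. This bound dominates the
  passage from finitely many poles to all of them.
\<close>

lemma symm_sums_bounded:
  assumes "\<delta> > 0"
  obtains B where "\<And>z N. \<lbrakk>norm z \<le> M; \<And>k. \<delta> \<le> norm (z - complex_of_int k)\<rbrakk> \<Longrightarrow>
      norm (symm_sum (\<lambda>k. 1 / (z - of_int k)) N) \<le> B \<and> symm_sum (\<lambda>k. 1 / (norm (z - of_int k))\<^sup>2) N \<le> B"
proof -
  \<comment> \<open>The constant for which \<open>|k| \<le> A |z - k|\<close>, by \<open>|k| \<le> |z - k| + |z|\<close> and \<open>|z| \<le> (M / \<delta>) |z - k|\<close>.\<close>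
  define A where "A = 1 + \<bar>M\<bar> / \<delta>"
  define S where "S = (\<Sum>n. 1 / (real n + 1)\<^sup>2)"
  have A: "A \<ge> 1" using assms by (simp add: A_def)
  have sumS: "summable (\<lambda>n. 1 / (real n + 1)\<^sup>2)" using sums_summable[OF inverse_squares_sums] by (simp add: add.commute)
  define B where "B = (1 / \<delta> + 2 * \<bar>M\<bar> * A\<^sup>2 * S) + ((1 / \<delta>)\<^sup>2 + 2 * A\<^sup>2 * S)"
  have S: "S \<ge> 0" unfolding S_def by (intro suminf_nonneg sumS) auto
  have "norm (symm_sum (\<lambda>k. 1 / (z - of_int k)) N) \<le> B \<and> symm_sum (\<lambda>k. 1 / (norm (z - of_int k))\<^sup>2) N \<le> B"
    if z: "norm z \<le> M" and d: "\<And>k. \<delta> \<le> norm (z - complex_of_int k)" for z N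
  proof -
    have pos: "norm (z - of_int k) > 0" for k using d[of k] assms by linarith
    have low: "1 / norm (z - of_int k) \<le> A / \<bar>real_of_int k\<bar>" if "k \<noteq> 0" for k
    proof -
      have "\<bar>real_of_int k\<bar> \<le> norm (z - of_int k) + norm z"
        using norm_triangle_ineq4[of z "z - of_int k"] by simp
      also have "norm z \<le> \<bar>M\<bar> / \<delta> * norm (z - of_int k)"
      proof -
        have "\<bar>M\<bar> / \<delta> * \<delta> \<le> \<bar>M\<bar> / \<delta> * norm (z - of_int k)"
          using assms by (intro mult_left_mono d) auto
        then show ?thesis using assms z by simp
      qed
      finally have "\<bar>real_of_int k\<bar> \<le> A * norm (z - of_int k)" by (simp add: A_def algebra_simps)
      then show ?thesis using pos[of k] that by (simp add: field_simps)
    qed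
    have lowsq: "1 / (norm (z - of_int k))\<^sup>2 \<le> A\<^sup>2 / (real_of_int k)\<^sup>2" if "k \<noteq> 0" for k
      using power_mono[OF low[OF that], of 2] by (simp add: power_divide)
    have S_ge: "(\<Sum>n<N. 1 / (real n + 1)\<^sup>2) \<le> S"
      unfolding S_def by (intro sum_le_suminf sumS) auto
    \<comment> \<open>Pairing \<open>k\<close> with \<open>- k\<close> gains the second factor \<open>1 / |k|\<close>.\<close>
    have one: "norm (1 / (z - of_int (int (Suc n))) + 1 / (z - of_int (- int (Suc n)))) \<le> 2 * \<bar>M\<bar> * A\<^sup>2 * (1 / (real n + 1)\<^sup>2)" for n
    proof -
      let ?p = "z - of_int (int (Suc n))" and ?q = "z - of_int (- int (Suc n))"
      have nz: "?p \<noteq> 0" "?q \<noteq> 0"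
        using pos[of "int (Suc n)"] pos[of "- int (Suc n)"] by (metis norm_zero less_irrefl)+
      have "1 / ?p + 1 / ?q = (?p + ?q) / (?p * ?q)" using nz by (simp add: field_simps)
      also have "?p + ?q = 2 * z" by simp
      finally have "norm (1 / ?p + 1 / ?q) = 2 * norm z * ((1 / norm ?p) * (1 / norm ?q))"
        by (simp add: norm_mult norm_divide)
      also have "\<dots> \<le> 2 * \<bar>M\<bar> * ((A / \<bar>real_of_int (int (Suc n))\<bar>) * (A / \<bar>real_of_int (- int (Suc n))\<bar>))"
        by (intro mult_mono low) (use z A in auto)
      also have "\<dots> = 2 * \<bar>M\<bar> * A\<^sup>2 * (1 / (real n + 1)\<^sup>2)" by (simp add: power2_eq_square add_ac)
      finally show ?thesis .
    qed
    have z0: "1 / norm (z - of_int 0) \<le> 1 / \<delta>"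
      using d[of 0] assms by (simp add: frac_le)
    have "norm (symm_sum (\<lambda>k. 1 / (z - of_int k)) N) \<le> norm (1 / (z - of_int 0))
        + (\<Sum>n<N. norm (1 / (z - of_int (int (Suc n))) + 1 / (z - of_int (- int (Suc n)))))"
      unfolding symm_sum_eq by (intro norm_triangle_le add_left_mono norm_sum)
    also have "\<dots> \<le> 1 / \<delta> + (\<Sum>n<N. 2 * \<bar>M\<bar> * A\<^sup>2 * (1 / (real n + 1)\<^sup>2))"
      using z0 by (intro add_mono sum_mono one) (simp add: norm_divide)
    also have "\<dots> \<le> 1 / \<delta> + 2 * \<bar>M\<bar> * A\<^sup>2 * S"
      unfolding sum_distrib_left[symmetric] by (intro add_left_mono mult_left_mono S_ge) auto
    finally have 1: "norm (symm_sum (\<lambda>k. 1 / (z - of_int k)) N) \<le> 1 / \<delta> + 2 * \<bar>M\<bar> * A\<^sup>2 * S" .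
    have two: "1 / (norm (z - of_int (int (Suc n))))\<^sup>2 + 1 / (norm (z - of_int (- int (Suc n))))\<^sup>2
        \<le> 2 * A\<^sup>2 * (1 / (real n + 1)\<^sup>2)" for n
    proof -
      have "(real_of_int (int (Suc n)))\<^sup>2 = (real n + 1)\<^sup>2" "(real_of_int (- int (Suc n)))\<^sup>2 = (real n + 1)\<^sup>2"
        by (simp_all add: power2_eq_square algebra_simps)
      then have "1 / (norm (z - of_int (int (Suc n))))\<^sup>2 \<le> A\<^sup>2 / (real n + 1)\<^sup>2"
          "1 / (norm (z - of_int (- int (Suc n))))\<^sup>2 \<le> A\<^sup>2 / (real n + 1)\<^sup>2"
        using lowsq[of "int (Suc n)"] lowsq[of "- int (Suc n)"] by (metis neg_equal_0_iff_equal nat.distinct(1) of_nat_eq_0_iff)+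
      then show ?thesis by simp
    qed
    have "symm_sum (\<lambda>k. 1 / (norm (z - of_int k))\<^sup>2) N \<le> (1 / \<delta>)\<^sup>2 + (\<Sum>n<N. 2 * A\<^sup>2 * (1 / (real n + 1)\<^sup>2))"
      unfolding symm_sum_eq using power_mono[OF z0, of 2]
      by (intro add_mono sum_mono two) (simp add: power_divide)
    also have "\<dots> \<le> (1 / \<delta>)\<^sup>2 + 2 * A\<^sup>2 * S"
      unfolding sum_distrib_left[symmetric] by (intro add_left_mono mult_left_mono S_ge) auto
    finally have 2: "symm_sum (\<lambda>k. 1 / (norm (z - of_int k))\<^sup>2) N \<le> (1 / \<delta>)\<^sup>2 + 2 * A\<^sup>2 * S" .
    have "1 / \<delta> + 2 * \<bar>M\<bar> * A\<^sup>2 * S \<ge> 0" "(1 / \<delta>)\<^sup>2 + 2 * A\<^sup>2 * S \<ge> 0"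
      using S assms by (auto intro!: add_nonneg_nonneg mult_nonneg_nonneg)
    with 1 2 show ?thesis unfolding B_def by linarith
  qed
  then show thesis by (rule that)
qed

lemma dist_Ints_pos:
  fixes z :: complex
  assumes "z \<notin> \<int>"
  obtains \<delta> where "\<delta> > 0" "\<And>k. \<delta> \<le> norm (z - of_int k)"
proof -
  have "open (- (\<int> :: complex set))" using closed_Ints by (simp add: open_Compl)
  then obtain \<delta> where d: "\<delta> > 0" "ball z \<delta> \<subseteq> - \<int>"
    using assms by (meson ComplI open_contains_ball)
  have "\<delta> \<le> norm (z - of_int k)" for k
  proof (rule ccontr)
    assume "\<not> ?thesis"
    then have "complex_of_int k \<in> ball z \<delta>" by (simp add: dist_norm)
    with d show False by auto
  qed
  with d that show thesis by blast
qed

lemma inverse_square_dist_summable: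
  fixes z :: complex
  assumes "z \<notin> \<int>"
  shows "(\<lambda>k::int. 1 / (norm (z - of_int k))\<^sup>2) summable_on UNIV"
proof -
  obtain \<delta> where d: "\<delta> > 0" "\<And>k::int. \<delta> \<le> norm (z - of_int k)" by (rule dist_Ints_pos[OF assms]) blast
  obtain B where "\<And>N. symm_sum (\<lambda>k. 1 / (norm (z - of_int k))\<^sup>2) N \<le> B"
    by (rule symm_sums_bounded[OF d(1), of "norm z"]) (use d(2) in blast)
  then show ?thesis by (intro summable_on_int_if_symm_sum_bounded) auto
qed

lemma x_coth_mono:
  fixes x y :: real
  assumes "0 < x" "x \<le> y"
  shows "x * coth x \<le> y * coth y"
proof (rule DERIV_nonneg_imp_nondecreasing[OF assms(2)])
  fix t assume "x \<le> t" "t \<le> y"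
  then have t: "t > 0" using assms by simp
  then have sh: "sinh t > 0" by simp
  have "((\<lambda>t. t * (cosh t / sinh t)) has_real_derivative
     (cosh t / sinh t + t * ((sinh t * sinh t - cosh t * cosh t) / (sinh t * sinh t)))) (at t)"
    using sh by (auto intro!: derivative_eq_intros simp: field_simps)
  moreover have "sinh t * sinh t - cosh t * cosh t = -1"
    using cosh_square_eq[of t] by (simp add: power2_eq_square)
  moreover have "t \<le> sinh t * cosh t"
  proof -
    have "0 - sinh 0 \<ge> t - sinh t"
      by (rule DERIV_nonpos_imp_nonincreasing[where f = "\<lambda>t. t - sinh t"])
        (use t cosh_real_ge_1 in \<open>auto intro!: derivative_eq_intros exI\<close>)
    then have "t \<le> sinh t" by simp
    also have "sinh t \<le> sinh t * cosh t" using sh cosh_real_ge_1[of t] by simp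
    finally show ?thesis .
  qed
  ultimately show "\<exists>D. DERIV (\<lambda>t. t * coth t) t :> D \<and> D \<ge> 0"
    unfolding coth_def using sh
    by (intro exI[of _ "cosh t / sinh t + t * (- 1 / (sinh t * sinh t))"]) (simp add: field_simps)
qed

section \<open>A bound for the cotangent in a strip\<close>

lemma cot_modulus_and_Im:
  fixes z :: complex
  assumes "Im z \<noteq> 0"
  shows "sin z \<noteq> 0"
    and "(norm (cot z))\<^sup>2 * (norm (sin z))\<^sup>2 \<le> (cosh (Im z))\<^sup>2"
    and "- Im (cot z) * (norm (sin z))\<^sup>2 = sinh (Im z) * cosh (Im z)"
proof -
  define p q where "p = Re z" and "q = Im z"
  have re: "Re (sin z) = sin p * cosh q" "Im (sin z) = cos p * sinh q"
    "Re (cos z) = cos p * cosh q" "Im (cos z) = - sin p * sinh q"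
    by (simp_all add: Re_sin Im_sin Re_cos Im_cos p_def q_def cosh_def sinh_def field_simps)
  have sc: "(sin p)\<^sup>2 = 1 - (cos p)\<^sup>2" "(cosh q)\<^sup>2 = 1 + (sinh q)\<^sup>2"
    by (simp_all add: sin_squared_eq cosh_square_eq)
  have q: "sinh q \<noteq> 0" using assms by (simp add: q_def)
  show nz: "sin z \<noteq> 0"
  proof
    assume "sin z = 0"
    then have "sin p = 0" "cos p = 0" using re q by auto
    then show False using sin_cos_squared_add[of p] by simp
  qed
  have ns: "(norm (sin z))\<^sup>2 = (Re (sin z))\<^sup>2 + (Im (sin z))\<^sup>2" by (rule cmod_power2)
  have "(norm (cos z))\<^sup>2 = (cos p)\<^sup>2 * (1 + (sinh q)\<^sup>2) + (1 - (cos p)\<^sup>2) * (sinh q)\<^sup>2"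
    by (simp add: cmod_power2 re power_mult_distrib sc)
  also have "\<dots> = (cos p)\<^sup>2 + (sinh q)\<^sup>2" by (simp add: algebra_simps)
  also have "\<dots> \<le> (cosh q)\<^sup>2" using sc(2) cos_le_one[of p] abs_cos_le_one[of p]
    by (simp add: abs_square_le_1)
  finally show "(norm (cot z))\<^sup>2 * (norm (sin z))\<^sup>2 \<le> (cosh (Im z))\<^sup>2"
    using nz by (simp add: cot_def norm_divide power_divide q_def)
  have "Im (cot z) * (norm (sin z))\<^sup>2 = Im (cos z) * Re (sin z) - Re (cos z) * Im (sin z)"
  proof -
    have "(norm (sin z))\<^sup>2 \<noteq> 0" using nz by simp
    then show ?thesis unfolding cot_def Im_divide ns by simp
  qed
  also have "\<dots> = - (((sin p)\<^sup>2 + (cos p)\<^sup>2) * sinh q * cosh q)"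
    unfolding re by algebra
  finally show "- Im (cot z) * (norm (sin z))\<^sup>2 = sinh (Im z) * cosh (Im z)"
    by (simp add: q_def)
qed

lemma Im_symm_sum_inverse:
  "Im (symm_sum (\<lambda>k. 1 / (z - of_int k)) N) = - Im z * symm_sum (\<lambda>k. 1 / (norm (z - of_int k))\<^sup>2) N"
proof -
  have "Im (1 / (z - of_int k)) = - Im z * (1 / (norm (z - of_int k))\<^sup>2)" for k
    by (simp add: Im_divide cmod_power2)
  then show ?thesis
    unfolding symm_sum_def Im_sum sum_distrib_left by (intro sum.cong) auto
qed

text \<open>
  With \<open>q = \<pi> Im z\<close>, the previous estimates reduce the claim to \<open>q cosh q \<le> Y sinh q\<close>.
\<close>

lemma pi_cot_norm_le_upper:
  fixes z :: complex
  assumes b: "Im z > 0" and Y: "pi * Im z * coth (pi * Im z) \<le> Y"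
  shows "(norm (of_real pi * cot (of_real pi * z)))\<^sup>2 \<le> Y * (\<Sum>\<^sub>\<infinity>k. 1 / (norm (z - of_int k))\<^sup>2)"
proof -
  define S where "S = (\<Sum>\<^sub>\<infinity>k. 1 / (norm (z - of_int k))\<^sup>2)"
  define q where "q = pi * Im z"
  define c where "c = cot (of_real pi * z)"
  have q: "q > 0" using b by (simp add: q_def)
  have z: "z \<notin> \<int>" using b by (auto elim: Ints_cases)
  have "symm_sum (\<lambda>k. 1 / (norm (z - of_int k))\<^sup>2) \<longlonglongrightarrow> S"
    unfolding S_def using inverse_square_dist_summable[OF z] by (intro symm_sum_tendsto_has_sum) auto
  then have "(\<lambda>N. - Im z * symm_sum (\<lambda>k. 1 / (norm (z - of_int k))\<^sup>2) N) \<longlonglongrightarrow> - Im z * S"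
    by (intro tendsto_intros)
  moreover have "(\<lambda>N. Im (symm_sum (\<lambda>k. 1 / (z - of_int k)) N)) \<longlonglongrightarrow> Im (of_real pi * c)"
    unfolding c_def by (intro tendsto_Im pi_cot_partial_fractions z)
  ultimately have Im: "Im (of_real pi * c) = - Im z * S"
    unfolding Im_symm_sum_inverse by (rule LIMSEQ_unique[rotated])
  then have S: "S = (pi / Im z) * (- Im c)" using b by (simp add: field_simps)
  let ?s = "(norm (sin (of_real pi * z)))\<^sup>2"
  have imq: "Im (of_real pi * z) = q" by (simp add: q_def)
  have "Im (of_real pi * z) \<noteq> 0" using imq q by simp
  note cot = cot_modulus_and_Im[OF this, folded c_def, unfolded imq]
  have s: "?s > 0" using cot(1) by simp
  have qc: "q * cosh q \<le> Y * sinh q"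
    using Y q unfolding q_def[symmetric] coth_def by (simp add: field_simps)
  have "(norm (of_real pi * c))\<^sup>2 * ?s = pi\<^sup>2 * ((norm c)\<^sup>2 * ?s)"
    by (simp add: norm_mult power_mult_distrib)
  also have "\<dots> \<le> pi\<^sup>2 * (cosh q)\<^sup>2" by (intro mult_left_mono cot(2)) auto
  also have "\<dots> = (pi / Im z) * cosh q * (q * cosh q)"
    using b by (simp add: q_def power2_eq_square)
  also have "\<dots> \<le> (pi / Im z) * cosh q * (Y * sinh q)"
    using b by (intro mult_left_mono qc) auto
  also have "\<dots> = Y * (pi / Im z) * (sinh q * cosh q)" by simp
  also have "\<dots> = Y * S * ?s" unfolding cot(3)[symmetric] S by simp
  finally show ?thesis using s unfolding S_def c_def by simp
qed

text \<open>
  On the real axis the bound is the limit of the one in the upper half plane, since \<open>t coth t\<close> tends to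
  \<open>1\<close> and moving \<open>z\<close> off the axis only decreases the sum. Points on the axis cannot be discarded as
  a null set: for \<open>d = 1\<close> they are the whole space.
\<close>

lemma pi_cot_norm_le_real:
  fixes a :: real
  assumes z: "complex_of_real a \<notin> \<int>"
  shows "(norm (of_real pi * cot (of_real pi * complex_of_real a)))\<^sup>2 \<le> (\<Sum>\<^sub>\<infinity>k. 1 / (norm (complex_of_real a - of_int k))\<^sup>2)"
    (is "?L \<le> ?S")
proof -
  define y where "y b = pi * b * coth (pi * b)" for b :: real
  have le: "(norm (of_real pi * cot (of_real pi * Complex a b)))\<^sup>2 \<le> y b * ?S" if b: "b > 0" for b
  proof -
    have nz: "Complex a b \<notin> \<int>" using b by (auto elim!: Ints_cases simp: complex_eq_iff)
    have "(norm (of_real pi * cot (of_real pi * Complex a b)))\<^sup>2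
      \<le> y b * (\<Sum>\<^sub>\<infinity>k. 1 / (norm (Complex a b - of_int k))\<^sup>2)"
      by (rule pi_cot_norm_le_upper) (use b in \<open>simp_all add: y_def\<close>)
    also have "\<dots> \<le> y b * ?S"
    proof (intro mult_left_mono infsum_mono inverse_square_dist_summable nz z)
      fix k :: int
      have "norm (complex_of_real a - of_int k) > 0"
        using z by (metis Ints_of_int right_minus_eq zero_less_norm_iff)
      moreover have "(norm (complex_of_real a - of_int k))\<^sup>2 \<le> (norm (Complex a b - of_int k))\<^sup>2"
        by (simp add: cmod_power2)
      ultimately show "1 / (norm (Complex a b - of_int k))\<^sup>2 \<le> 1 / (norm (complex_of_real a - of_int k))\<^sup>2"
        by (intro frac_le) auto
    qed (use b in \<open>auto simp: y_def coth_def\<close>)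
    finally show ?thesis .
  qed
  have sin: "sin (of_real pi * complex_of_real a) \<noteq> 0"
  proof
    assume "sin (of_real pi * complex_of_real a) = 0"
    then have "sin (pi * a) = 0"
      by (metis of_real_eq_0_iff of_real_mult sin_of_real)
    then obtain k where "pi * a = of_int k * pi" by (auto simp: sin_zero_iff_int2)
    then have "complex_of_real a = of_int k" by simp
    with z show False by auto
  qed
  have "((\<lambda>b. (norm (of_real pi * cot (of_real pi * Complex a b)))\<^sup>2) \<longlongrightarrow> 
      (norm (of_real pi * cot (of_real pi * Complex a 0)))\<^sup>2) (at_right 0)"
    unfolding cot_def using sin
    by (intro tendsto_intros) (auto simp: complex_of_real_def)
  moreover have "((\<lambda>b. y b * ?S) \<longlongrightarrow> 1 * ?S) (at_right 0)"
  proof (intro tendsto_intros)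
    show "(y \<longlongrightarrow> 1) (at_right 0)"
      unfolding y_def coth_def by real_asymp
  qed
  moreover have "\<forall>\<^sub>F b in at_right 0. (norm (of_real pi * cot (of_real pi * Complex a b)))\<^sup>2 \<le> y b * ?S"
    using le by (auto simp: eventually_at_filter)
  ultimately have "(norm (of_real pi * cot (of_real pi * Complex a 0)))\<^sup>2 \<le> 1 * ?S"
    by (intro tendsto_le[of "at_right (0::real)"]) auto
  then show ?thesis by (simp add: complex_of_real_def)
qed

lemma x_coth_ge_1: "x > 0 \<Longrightarrow> x * coth x \<ge> (1::real)"
proof -
  assume x: "x > 0"
  have "((\<lambda>t. t * coth t) \<longlongrightarrow> (1::real)) (at_right 0)"
    unfolding coth_def by real_asymp
  moreover have "\<forall>\<^sub>F t in at_right 0. t * coth t \<le> x * coth x"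
    using x x_coth_mono[of _ x] by (auto simp: eventually_at_right intro!: exI[of _ x])
  ultimately show ?thesis by (intro tendsto_upperbound) auto
qed

lemma pi_cot_norm_le:
  fixes z :: complex
  assumes z: "z \<notin> \<int>" and b: "0 \<le> Im z" "Im z \<le> B" and B: "B > 0"
  shows "(norm (of_real pi * cot (of_real pi * z)))\<^sup>2
    \<le> (pi * B * coth (pi * B)) * (\<Sum>\<^sub>\<infinity>k. 1 / (norm (z - of_int k))\<^sup>2)"
proof (cases "Im z = 0")
  case False
  then show ?thesis using b B by (intro pi_cot_norm_le_upper x_coth_mono) auto
next
  case True
  then have za: "z = complex_of_real (Re z)" by (simp add: complex_eq_iff)
  have "(norm (of_real pi * cot (of_real pi * z)))\<^sup>2 \<le> 1 * (\<Sum>\<^sub>\<infinity>k. 1 / (norm (z - of_int k))\<^sup>2)"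
    using pi_cot_norm_le_real[of "Re z"] z unfolding za[symmetric] by simp
  also have "\<dots> \<le> (pi * B * coth (pi * B)) * (\<Sum>\<^sub>\<infinity>k. 1 / (norm (z - of_int k))\<^sup>2)"
    using B by (intro mult_right_mono x_coth_ge_1 infsum_nonneg) auto
  finally show ?thesis .
qed

section \<open>Integration by parts against the field of one pole\<close>

lemma integrable_compact_support:
  fixes f :: "'a::euclidean_space \<Rightarrow> real"
  assumes "compact K" "continuous_on K f" "\<And>x. x \<notin> K \<Longrightarrow> f x = 0"
  shows "integrable lborel f"
proof -
  have "(\<lambda>x. indicator K x *\<^sub>R f x) = f"
    using assms(3) by (auto simp: fun_eq_iff indicator_def)
  then show ?thesis using borel_integrable_compact[OF assms(1,2)] by simp
qed

lemma lborel_integral_translation: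
  fixes f :: "'a::euclidean_space \<Rightarrow> real"
  assumes "f \<in> borel_measurable borel"
  shows "(\<integral>x. f (x + c) \<partial>lborel) = (\<integral>x. f x \<partial>lborel)"
proof -
  have "(\<integral>x. f x \<partial>lborel) = (\<integral>x. f x \<partial>distr lborel borel ((+) c))"
    by (simp add: lborel_distr_plus)
  also have "\<dots> = (\<integral>x. f (c + x) \<partial>lborel)"
    by (rule integral_distr) (use assms in auto)
  finally show ?thesis by (simp add: add.commute)
qed

lemma lborel_integrable_translation:
  fixes f :: "'a::euclidean_space \<Rightarrow> real"
  assumes "integrable lborel f"
  shows "integrable lborel (\<lambda>x. f (x + c))"
proof -
  have "integrable (distr lborel borel ((+) c)) f"
    using assms by (simp add: lborel_distr_plus)
  then have "integrable lborel (\<lambda>x. f (c + x))"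
    by (subst (asm) integrable_distr_eq) (use assms in auto)
  then show ?thesis by (simp add: add.commute)
qed

text \<open>
  The integral of a difference quotient of \<open>w\<close> vanishes by translation invariance. Dominated convergence,
  with a bound from the mean value theorem, carries this over to the derivative.
\<close>

lemma integral_directional_derivative_eq_0:
  fixes w :: "'a::euclidean_space \<Rightarrow> real"
  assumes K: "compact K" and w0: "\<And>x. x \<notin> K \<Longrightarrow> w x = 0"
    and deriv: "\<And>x. (w has_derivative w' x) (at x)"
    and cont: "continuous_on K (\<lambda>x. w' x v)"
    and w'0: "\<And>x. x \<notin> K \<Longrightarrow> w' x v = 0"
  shows "(\<integral>x. w' x v \<partial>lborel) = 0"
proof -
  have cw: "continuous_on UNIV w"
    by (intro continuous_at_imp_continuous_on ballI has_derivative_continuous[OF deriv])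
  have [measurable]: "w \<in> borel_measurable borel" using cw by (rule borel_measurable_continuous_onI)
  have int_w: "integrable lborel w"
    using K continuous_on_subset[OF cw] w0 by (intro integrable_compact_support[of K]) auto
  have int_w': "integrable lborel (\<lambda>x. w' x v)"
    using K cont w'0 by (rule integrable_compact_support)
  have "compact ((\<lambda>x. w' x v) ` K)" using cont K by (rule compact_continuous_image)
  then obtain B where B: "\<And>x. x \<in> K \<Longrightarrow> norm (w' x v) \<le> B"
    using compact_imp_bounded bounded_iff by (metis imageI)
  have B': "norm (w' x v) \<le> \<bar>B\<bar>" for x
    by (cases "x \<in> K") (use B[of x] w'0[of x] in auto)
  obtain M where M: "\<And>x. x \<in> K \<Longrightarrow> norm x \<le> M"
    using K compact_imp_bounded bounded_iff by metis
  define f where "f n x = (w (x + inverse (real (Suc n)) *\<^sub>R v) - w x) / inverse (real (Suc n))" for n x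
  have line: "((\<lambda>s. w (x + s *\<^sub>R v)) has_real_derivative w' (x + s *\<^sub>R v) v) (at s)" for x s
  proof -
    have "((\<lambda>s. x + s *\<^sub>R v) has_derivative (\<lambda>t. t *\<^sub>R v)) (at s)"
      by (auto intro!: derivative_eq_intros)
    from has_derivative_compose[OF this deriv]
    have "((\<lambda>s. w (x + s *\<^sub>R v)) has_derivative (\<lambda>t. w' (x + s *\<^sub>R v) (t *\<^sub>R v))) (at s)" .
    moreover have "(\<lambda>t. w' (x + s *\<^sub>R v) (t *\<^sub>R v)) = (*) (w' (x + s *\<^sub>R v) v)"
      using linear_scale[OF has_derivative_linear[OF deriv[of "x + s *\<^sub>R v"]]]
      by (auto simp: fun_eq_iff)
    ultimately show ?thesis by (simp add: has_field_derivative_def)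
  qed
  have "(\<lambda>n. \<integral>x. f n x \<partial>lborel) \<longlonglongrightarrow> (\<integral>x. w' x v \<partial>lborel)"
  proof (rule integral_dominated_convergence[where w = "\<lambda>x. indicator (cball 0 (M + norm v)) x * \<bar>B\<bar>"])
    show "integrable lborel (\<lambda>x::'a. indicator (cball 0 (M + norm v)) x * \<bar>B\<bar>)"
      using emeasure_compact_finite[OF compact_cball[of "0::'a" "M + norm v"]]
      by (intro integrable_mult_left integrable_real_indicator) auto
    show "AE x in lborel. (\<lambda>n. f n x) \<longlonglongrightarrow> w' x v"
    proof (intro AE_I2)
      fix x
      have "(\<lambda>s. (w (x + s *\<^sub>R v) - w x) / s) \<midarrow>0\<rightarrow> w' x v"
        using line[of x 0] by (simp add: DERIV_def)
      moreover have "filterlim (\<lambda>n. inverse (real (Suc n))) (at 0) sequentially"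
        using LIMSEQ_inverse_real_of_nat by (auto simp: filterlim_at)
      ultimately show "(\<lambda>n. f n x) \<longlonglongrightarrow> w' x v"
        unfolding f_def by (rule filterlim_compose)
    qed
    fix n
    show "AE x in lborel. norm (f n x) \<le> indicator (cball 0 (M + norm v)) x * \<bar>B\<bar>"
    proof (intro AE_I2)
      fix x
      let ?t = "inverse (real (Suc n))"
      have t: "0 < ?t" "?t \<le> 1" by (auto simp: inverse_le_1_iff)
      show "norm (f n x) \<le> indicator (cball 0 (M + norm v)) x * \<bar>B\<bar>"
      proof (cases "x \<in> cball 0 (M + norm v)")
        case True
        obtain s where "w (x + ?t *\<^sub>R v) - w (x + 0 *\<^sub>R v) = (?t - 0) * w' (x + s *\<^sub>R v) v"
          using MVT2[OF t(1) line] by blast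
        then have "f n x = w' (x + s *\<^sub>R v) v" using t unfolding f_def by simp
        then show ?thesis using True B'[of "x + s *\<^sub>R v"] by simp
      next
        case False
        have "norm x \<le> norm (x + ?t *\<^sub>R v) + norm v"
        proof -
          have "norm x \<le> norm (x + ?t *\<^sub>R v) + norm (?t *\<^sub>R v)"
            using norm_triangle_ineq4[of "x + ?t *\<^sub>R v" "?t *\<^sub>R v"] by simp
          also have "norm (?t *\<^sub>R v) \<le> 1 * norm v"
            unfolding norm_scaleR using t by (intro mult_right_mono) auto
          finally show ?thesis by simp
        qed
        then have "x + ?t *\<^sub>R v \<notin> K" "x \<notin> K"
          using False M[of "x + ?t *\<^sub>R v"] M[of x] norm_ge_zero[of v] by auto
        then show ?thesis using w0 False by (simp add: f_def)
      qed
    qed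
  qed (use int_w' in \<open>auto simp: f_def\<close>)
  moreover have "(\<integral>x. f n x \<partial>lborel) = 0" for n
  proof -
    have "(\<integral>x. f n x \<partial>lborel) = ((\<integral>x. w (x + inverse (real (Suc n)) *\<^sub>R v) \<partial>lborel) - (\<integral>x. w x \<partial>lborel)) / inverse (real (Suc n))"
      unfolding f_def by (subst Bochner_Integration.integral_diff[symmetric]) (auto intro: int_w lborel_integrable_translation)
    then show ?thesis by (simp add: lborel_integral_translation)
  qed
  ultimately show ?thesis by (simp add: LIMSEQ_const_iff)
qed

lemma smooth_differentiable: "smooth u \<Longrightarrow> u differentiable (at x)"
  unfolding smooth_def by (metis times_cont_diff.simps(2))

lemma smooth_continuous: "smooth u \<Longrightarrow> continuous_on S u"
  unfolding smooth_def by (metis times_cont_diff.simps(1) continuous_on_subset subset_UNIV)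

lemma smooth_partial: "smooth u \<Longrightarrow> smooth (partial_deriv i u)"
  unfolding smooth_def by (metis times_cont_diff.simps(2))

lemma smooth_has_derivative:
  fixes u :: "real ^ 'n \<Rightarrow> real"
  assumes "smooth u"
  shows "(u has_derivative (\<lambda>v. gradient u x \<bullet> v)) (at x)"
proof -
  let ?D = "frechet_derivative u (at x)"
  have D: "(u has_derivative ?D) (at x)"
    using smooth_differentiable[OF assms] by (simp add: frechet_derivative_works)
  then have lin: "linear ?D" by (rule has_derivative_linear)
  have "?D v = gradient u x \<bullet> v" for v
  proof -
    have "?D v = ?D (\<Sum>i\<in>UNIV. (v $ i) *\<^sub>R axis i 1)"
      by (simp add: basis_expansion scalar_mult_eq_scaleR[symmetric])
    also have "\<dots> = (\<Sum>i\<in>UNIV. (v $ i) * ?D (axis i 1))"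
      by (simp add: linear_sum[OF lin] linear_scale[OF lin])
    also have "\<dots> = gradient u x \<bullet> v"
      by (simp add: gradient_def partial_deriv_def inner_vec_def mult.commute)
    finally show ?thesis .
  qed
  then have "?D = (\<lambda>v. gradient u x \<bullet> v)" by (rule ext)
  then show ?thesis using D by simp
qed

lemma smooth_continuous_gradient:
  assumes "smooth u" shows "continuous_on S (gradient u)"
  unfolding gradient_def[abs_def]
  by (intro continuous_on_vec_lambda smooth_continuous smooth_partial assms)

lemma gradient_eq_0:
  assumes "smooth u" "open A" "x \<in> A" "\<And>y. y \<in> A \<Longrightarrow> u y = 0"
  shows "gradient u x = 0"
proof -
  have "((\<lambda>_. 0) has_derivative (\<lambda>v. gradient u x \<bullet> v)) (at x)"
    using smooth_has_derivative[OF assms(1)] assms(2-)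
    by (rule has_derivative_transform_within_open) 
  then have "(\<lambda>v. gradient u x \<bullet> v) = (\<lambda>_. 0)"
    by (rule has_derivative_unique) (rule has_derivative_const)
  then have "gradient u x \<bullet> gradient u x = 0" by metis
  then show ?thesis by simp
qed

text \<open>
  The identity \<open>\<integral> div (u\<^sup>2 F) = 0\<close> for \<open>F x = (x - a) / |x - a|\<^sup>2\<close>, whose divergence is
  \<open>(d - 2) / |x - a|\<^sup>2\<close>.
\<close>

lemma hardy_divergence_identity:
  fixes u :: "real ^ 'n \<Rightarrow> real"
  assumes u: "smooth u" and K: "compact K" and u0: "\<And>x. x \<notin> K \<Longrightarrow> u x = 0" and a: "a \<notin> K"
  shows "integrable lborel (\<lambda>x. 2 * u x * (gradient u x \<bullet> (x - a)) / (norm (x - a))\<^sup>2)" (is "integrable lborel ?f")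
    and "integrable lborel (\<lambda>x. (u x)\<^sup>2 / (norm (x - a))\<^sup>2)" (is "integrable lborel ?g")
    and "(\<integral>x. 2 * u x * (gradient u x \<bullet> (x - a)) / (norm (x - a))\<^sup>2 \<partial>lborel)
      = - (real CARD('n) - 2) * (\<integral>x. (u x)\<^sup>2 / (norm (x - a))\<^sup>2 \<partial>lborel)"
proof -
  have oK: "open (- K)" using K by (simp add: compact_imp_closed open_Compl)
  have g0: "gradient u x = 0" if "x \<notin> K" for x
    by (rule gradient_eq_0[OF u oK]) (use that u0 in auto)
  have xa: "x \<in> K \<Longrightarrow> x \<noteq> a" for x using a by auto
  note cont = smooth_continuous[OF u] smooth_continuous_gradient[OF u]
  show f: "integrable lborel ?f" and g: "integrable lborel ?g"
    using K by (rule integrable_compact_support; use xa u0 in \<open>auto intro!: continuous_intros cont\<close>)+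
  \<comment> \<open>The derivative of the \<open>i\<close>-th component of \<open>u\<^sup>2 F\<close>. The formula also holds outside \<open>K\<close>, where \<open>u\<close> and its
    gradient vanish, so the value given to \<open>F a\<close> is irrelevant.\<close>
  define D where "D i x v = 2 * u x * (gradient u x \<bullet> v) * ((x - a) $ i / (norm (x - a))\<^sup>2)
     + (u x)\<^sup>2 * ((v $ i) / (norm (x - a))\<^sup>2 - ((x - a) $ i) * (2 * ((x - a) \<bullet> v)) / ((norm (x - a))\<^sup>2)\<^sup>2)" for i x v
  have deriv: "((\<lambda>x. (u x)\<^sup>2 * ((x - a) $ i / (norm (x - a))\<^sup>2)) has_derivative D i x) (at x)" for i x
  proof (cases "x \<in> K")
    case True
    then have nz: "(x - a) \<bullet> (x - a) \<noteq> 0" using xa by auto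
    have "((\<lambda>x. (u x)\<^sup>2 * ((x - a) $ i / ((x - a) \<bullet> (x - a)))) has_derivative D i x) (at x)"
      unfolding D_def power2_norm_eq_inner
      using nz
      by (auto intro!: derivative_eq_intros smooth_has_derivative[OF u] bounded_linear_imp_has_derivative[OF bounded_linear_vec_nth] simp: fun_eq_iff inner_commute power2_eq_square divide_simps)
        (simp add: algebra_simps)
    then show ?thesis by (simp add: power2_norm_eq_inner)
  next
    case False
    have "((\<lambda>x. 0) has_derivative (\<lambda>_. 0)) (at x)" by simp
    then have "((\<lambda>x. (u x)\<^sup>2 * ((x - a) $ i / (norm (x - a))\<^sup>2)) has_derivative (\<lambda>_. 0)) (at x)"
      by (rule has_derivative_transform_within_open[OF _ oK]) (use False u0 in auto)
    moreover have "D i x = (\<lambda>_. 0)" using False u0 g0 by (simp add: D_def fun_eq_iff)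
    ultimately show ?thesis by simp
  qed
  have contD: "continuous_on K (\<lambda>x. D i x (axis i 1))" for i
    unfolding D_def using xa by (auto intro!: continuous_intros cont)
  have D0: "D i x (axis i 1) = 0" if "x \<notin> K" for i x
    using that u0 by (simp add: D_def)
  have "(\<integral>x. D i x (axis i 1) \<partial>lborel) = 0" for i
    by (rule integral_directional_derivative_eq_0[OF K _ deriv contD]) (use u0 D0 in auto)
  then have "0 = (\<Sum>i\<in>UNIV. \<integral>x. D i x (axis i 1) \<partial>lborel)" by simp
  also have "\<dots> = (\<integral>x. (\<Sum>i\<in>UNIV. D i x (axis i 1)) \<partial>lborel)"
    by (rule Bochner_Integration.integral_sum[symmetric], rule integrable_compact_support[OF K contD D0])
  also have "(\<lambda>x. \<Sum>i\<in>UNIV. D i x (axis i 1)) = (\<lambda>x. ?f x + (real CARD('n) - 2) * ?g x)"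
  proof
    fix x
    show "(\<Sum>i\<in>UNIV. D i x (axis i 1)) = ?f x + (real CARD('n) - 2) * ?g x"
    proof (cases "x \<in> K")
      case True
      then have nz: "(norm (x - a))\<^sup>2 \<noteq> 0" using xa by auto
      have s1: "(\<Sum>i\<in>UNIV. gradient u x $ i * ((x - a) $ i)) = gradient u x \<bullet> (x - a)"
        and s2: "(\<Sum>i\<in>UNIV. (x - a) $ i * ((x - a) $ i)) = (norm (x - a))\<^sup>2"
        by (simp_all add: inner_vec_def power2_norm_eq_inner)
      have "(\<Sum>i\<in>UNIV. D i x (axis i 1)) = (\<Sum>i\<in>UNIV. 2 * u x / (norm (x - a))\<^sup>2 * (gradient u x $ i * ((x - a) $ i))
          + (u x)\<^sup>2 / (norm (x - a))\<^sup>2 - 2 * (u x)\<^sup>2 / ((norm (x - a))\<^sup>2)\<^sup>2 * ((x - a) $ i * ((x - a) $ i)))"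
        by (intro sum.cong) (auto simp: D_def inner_axis algebra_simps simp del: vector_minus_component)
      also have "\<dots> = 2 * u x / (norm (x - a))\<^sup>2 * (gradient u x \<bullet> (x - a))
          + real CARD('n) * ((u x)\<^sup>2 / (norm (x - a))\<^sup>2) - 2 * (u x)\<^sup>2 / ((norm (x - a))\<^sup>2)\<^sup>2 * (norm (x - a))\<^sup>2"
        unfolding sum_subtractf sum.distrib sum_distrib_left[symmetric] s1 s2 by simp
      also have "\<dots> = ?f x + (real CARD('n) - 2) * ?g x"
      proof -
        have "U / n\<^sup>2 * n = U / n" if "n \<noteq> 0" for U n :: real
          using that by (simp add: power2_eq_square)
        from this[OF nz, of "2 * (u x)\<^sup>2"] show ?thesis by (simp add: algebra_simps diff_divide_distrib)
      qed
      finally show ?thesis .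
    next
      case False
      then show ?thesis using u0 by (simp add: D_def)
    qed
  qed
  also have "(\<integral>x. ?f x + (real CARD('n) - 2) * ?g x \<partial>lborel)
      = (\<integral>x. ?f x \<partial>lborel) + (real CARD('n) - 2) * (\<integral>x. ?g x \<partial>lborel)"
    using Bochner_Integration.integral_add[OF f integrable_mult_right[OF g, of "real CARD('n) - 2"]]
    by (simp only: integral_mult_right_zero)
  finally show "(\<integral>x. ?f x \<partial>lborel) = - (real CARD('n) - 2) * (\<integral>x. ?g x \<partial>lborel)" by linarith
qed

section \<open>The Hardy inequality on the cylinder\<close>

text \<open>The vector \<open>(1, \<dots>, 1)\<close>, which spans the axis of the cylinder.\<close>

definition diag_vec :: "real ^ 'n" where "diag_vec = (\<chi> i. 1)"

lemma pole_eq: "pole h k = (of_int k * h) *\<^sub>R diag_vec"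
  by (simp add: pole_def diag_vec_def vec_eq_iff)

lemma diag_vec_inner: "diag_vec \<bullet> (diag_vec :: real ^ 'n) = real CARD('n)"
  by (simp add: diag_vec_def inner_vec_def)

lemma norm_minus_diag:
  fixes x :: "real ^ 'n"
  shows "(norm (x - t *\<^sub>R diag_vec))\<^sup>2 = (norm x)\<^sup>2 - 2 * t * (x \<bullet> diag_vec) + t\<^sup>2 * real CARD('n)"
  by (simp add: power2_norm_eq_inner algebra_simps diag_vec_inner inner_commute power2_eq_square[of t])

text \<open>
  The orthogonal projection to the diagonal.
\<close>

definition axis_part :: "real ^ 'n \<Rightarrow> real ^ 'n"
  where "axis_part x = ((x \<bullet> diag_vec) / real CARD('n)) *\<^sub>R diag_vec"

text \<open>
  The coordinates of a point along and across the diagonal, scaled by \<open>\<surd>d\<close> so that the poles are mapped to the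
  integers when \<open>d h = 1\<close>; distances to the poles are then multiplied by \<open>\<surd>d\<close>.
\<close>

definition half_plane :: "real ^ 'n \<Rightarrow> complex"
  where "half_plane x = Complex (x \<bullet> diag_vec) (sqrt (real CARD('n)) * norm (x - axis_part x))"

lemma norm_minus_axis_part:
  fixes x :: "real ^ 'n"
  shows "(norm (x - axis_part x))\<^sup>2 = (norm x)\<^sup>2 - (x \<bullet> diag_vec)\<^sup>2 / real CARD('n)"
  unfolding axis_part_def norm_minus_diag by (simp add: power_divide power2_eq_square)

lemma diag_orthogonal: "(x - axis_part x) \<bullet> diag_vec = 0"
  by (simp add: axis_part_def inner_diff_left diag_vec_inner)

lemma Im_half_plane_sq:
  fixes x :: "real ^ 'n"
  shows "(Im (half_plane x))\<^sup>2 = real CARD('n) * (norm x)\<^sup>2 - (x \<bullet> diag_vec)\<^sup>2"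
  by (simp add: half_plane_def power_mult_distrib norm_minus_axis_part right_diff_distrib)

lemma norm_half_plane_minus_int:
  fixes x :: "real ^ 'n"
  assumes "real CARD('n) * h = 1"
  shows "(norm (half_plane x - of_int k))\<^sup>2 = real CARD('n) * (norm (x - pole h k))\<^sup>2"
proof -
  have "(norm (half_plane x - of_int k))\<^sup>2 = (x \<bullet> diag_vec - of_int k)\<^sup>2 + (Im (half_plane x))\<^sup>2"
    by (simp add: cmod_power2 half_plane_def)
  also have "\<dots> = real CARD('n) * (norm x)\<^sup>2 - 2 * of_int k * (x \<bullet> diag_vec) + (of_int k)\<^sup>2"
    unfolding Im_half_plane_sq by (simp add: power2_eq_square algebra_simps)
  also have "\<dots> = real CARD('n) * (norm (x - pole h k))\<^sup>2"
  proof -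
    have h: "h = 1 / real CARD('n)" using assms by (simp add: field_simps)
    show ?thesis unfolding pole_eq norm_minus_diag h by (simp add: power2_eq_square field_simps)
  qed
  finally show ?thesis .
qed

lemma half_plane_in_Ints:
  fixes x :: "real ^ 'n"
  assumes h: "real CARD('n) * h = 1"
  shows "half_plane x \<in> \<int> \<longleftrightarrow> x \<in> poles h"
proof -
  have "half_plane x = of_int k \<longleftrightarrow> x = pole h k" for k
    using norm_half_plane_minus_int[OF h, of x k] by auto
  then show ?thesis unfolding poles_def Ints_def by auto
qed

lemma continuous_on_half_plane: "continuous_on S half_plane"
  unfolding half_plane_def[abs_def] axis_part_def Complex_eq by (intro continuous_intros) auto

lemma Im_half_plane_cylinder:
  fixes x :: "real ^ 'n"
  assumes "x \<in> cylinder R"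
  shows "Im (half_plane x) \<le> R * sqrt (real CARD('n))"
proof -
  have le: "norm (x - axis_part x) \<le> norm (x - t *\<^sub>R diag_vec)" for t
  proof (rule power2_le_imp_le)
    have "x - t *\<^sub>R diag_vec = (x - axis_part x) + ((x \<bullet> diag_vec) / real CARD('n) - t) *\<^sub>R diag_vec"
      by (simp add: axis_part_def algebra_simps)
    then have "(norm (x - t *\<^sub>R diag_vec))\<^sup>2 = (norm (x - axis_part x))\<^sup>2
        + (norm (((x \<bullet> diag_vec) / real CARD('n) - t) *\<^sub>R (diag_vec :: real ^ 'n)))\<^sup>2"
      by (simp only:, intro norm_add_Pythagorean) (simp add: orthogonal_def diag_orthogonal)
    then show "(norm (x - axis_part x))\<^sup>2 \<le> (norm (x - t *\<^sub>R diag_vec))\<^sup>2" by simp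
  qed simp
  have "norm (x - axis_part x) \<le> infdist x diagonal"
  proof (subst infdist_notempty)
    show "norm (x - axis_part x) \<le> (INF a\<in>diagonal. dist x a)"
    proof (rule cINF_greatest)
      fix a :: "real ^ 'n" assume "a \<in> diagonal"
      then obtain t where "a = t *\<^sub>R diag_vec" by (auto simp: diagonal_def diag_vec_def vec_eq_iff)
      then show "norm (x - axis_part x) \<le> dist x a" using le by (simp add: dist_norm)
    qed (auto simp: diagonal_def)
  qed (auto simp: diagonal_def)
  also have "\<dots> \<le> R" using assms by (simp add: cylinder_def)
  finally show ?thesis by (simp add: half_plane_def mult.commute)
qed

text \<open>
  The superposition of the fields \<open>(x - a) / |x - a|\<^sup>2\<close> of the poles \<open>a\<^sub>k\<close> with \<open>|k| \<le> N\<close>.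
\<close>

definition pole_field :: "real \<Rightarrow> nat \<Rightarrow> real ^ 'n \<Rightarrow> real ^ 'n"
  where "pole_field h N x = symm_sum (\<lambda>k. (1 / (norm (x - pole h k))\<^sup>2) *\<^sub>R (x - pole h k)) N"

lemma norm_pole_field:
  fixes x :: "real ^ 'n"
  assumes h: "real CARD('n) * h = 1"
  shows "(norm (pole_field h N x))\<^sup>2 = real CARD('n) * (norm (symm_sum (\<lambda>k. 1 / (half_plane x - of_int k)) N))\<^sup>2"
proof -
  let ?d = "real CARD('n)"
  define z where "z = half_plane x"
  define y where "y = x - axis_part x"
  define Q where "Q = symm_sum (\<lambda>k. 1 / (norm (z - of_int k))\<^sup>2) N"
  define P where "P = symm_sum (\<lambda>k. (Re z - of_int k) / (norm (z - of_int k))\<^sup>2) N"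
  have d: "?d > 0" by simp
  have h': "h = 1 / ?d" using h by (simp add: field_simps)
  have summand: "(1 / (norm (x - pole h k))\<^sup>2) *\<^sub>R (x - pole h k)
      = ((Re z - of_int k) / (norm (z - of_int k))\<^sup>2) *\<^sub>R diag_vec + (?d * (1 / (norm (z - of_int k))\<^sup>2)) *\<^sub>R y" for k
  proof -
    have "x - pole h k = ((Re z - of_int k) / ?d) *\<^sub>R diag_vec + y"
      by (simp add: y_def axis_part_def z_def half_plane_def pole_eq h' algebra_simps diff_divide_distrib)
    moreover have "1 / (norm (x - pole h k))\<^sup>2 = ?d * (1 / (norm (z - of_int k))\<^sup>2)"
      unfolding z_def norm_half_plane_minus_int[OF h] by simp
    ultimately show ?thesis by (simp add: scaleR_add_right)
  qed
  have eq: "pole_field h N x = P *\<^sub>R diag_vec + (?d * Q) *\<^sub>R y"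
    unfolding pole_field_def summand P_def Q_def symm_sum_def sum.distrib scaleR_sum_left[symmetric] sum_distrib_left[symmetric] by simp
  have orth': "y \<bullet> diag_vec = 0" unfolding y_def by (rule diag_orthogonal)
  then have orth: "diag_vec \<bullet> y = 0" by (simp add: inner_commute)
  have "(norm (pole_field h N x))\<^sup>2 = P\<^sup>2 * ?d + ?d\<^sup>2 * Q\<^sup>2 * (norm y)\<^sup>2"
    unfolding eq power2_norm_eq_inner
    by (simp add: inner_add_left inner_add_right orth orth' diag_vec_inner power2_eq_square)
  also have "\<dots> = ?d * (P\<^sup>2 + (Im z * Q)\<^sup>2)"
    by (simp add: z_def half_plane_def y_def[symmetric] power_mult_distrib algebra_simps power2_eq_square)
  also have "P\<^sup>2 + (Im z * Q)\<^sup>2 = (norm (symm_sum (\<lambda>k. 1 / (z - of_int k)) N))\<^sup>2"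
  proof -
    have "Re (1 / (z - of_int k)) = (Re z - of_int k) / (norm (z - of_int k))\<^sup>2" for k
      by (simp add: Re_divide cmod_power2)
    then have "Re (symm_sum (\<lambda>k. 1 / (z - of_int k)) N) = P"
      unfolding symm_sum_def Re_sum P_def by simp
    moreover have "Im (symm_sum (\<lambda>k. 1 / (z - of_int k)) N) = - Im z * Q"
      unfolding Im_symm_sum_inverse Q_def ..
    ultimately show ?thesis by (simp add: cmod_power2)
  qed
  finally show ?thesis by (simp add: z_def)
qed

lemma potential_half_plane:
  fixes x :: "real ^ 'n"
  assumes h: "real CARD('n) * h = 1" and x: "x \<notin> poles h"
  shows "(\<lambda>k. 1 / (norm (x - pole h k))\<^sup>2) summable_on UNIV"
    and "potential h x = real CARD('n) * (\<Sum>\<^sub>\<infinity>k. 1 / (norm (half_plane x - of_int k))\<^sup>2)"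
    and "symm_sum (\<lambda>k. 1 / (norm (x - pole h k))\<^sup>2) \<longlonglongrightarrow> potential h x"
    and "symm_sum (\<lambda>k. 1 / (norm (x - pole h k))\<^sup>2) N
       = real CARD('n) * symm_sum (\<lambda>k. 1 / (norm (half_plane x - of_int k))\<^sup>2) N"
proof -
  have eq: "(\<lambda>k. 1 / (norm (x - pole h k))\<^sup>2) = (\<lambda>k. real CARD('n) * (1 / (norm (half_plane x - of_int k))\<^sup>2))"
    unfolding norm_half_plane_minus_int[OF h] by simp
  have z: "half_plane x \<notin> \<int>" using half_plane_in_Ints[OF h] x by blast
  note sm = inverse_square_dist_summable[OF z]
  show sm': "(\<lambda>k. 1 / (norm (x - pole h k))\<^sup>2) summable_on UNIV"
    unfolding eq by (intro summable_on_cmult_right sm)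
  show "potential h x = real CARD('n) * (\<Sum>\<^sub>\<infinity>k. 1 / (norm (half_plane x - of_int k))\<^sup>2)"
    unfolding potential_def eq by (intro infsum_cmult_right sm)
  show "symm_sum (\<lambda>k. 1 / (norm (x - pole h k))\<^sup>2) \<longlonglongrightarrow> potential h x"
    unfolding potential_def by (intro symm_sum_tendsto_has_sum has_sum_infsum sm')
  show "symm_sum (\<lambda>k. 1 / (norm (x - pole h k))\<^sup>2) N
       = real CARD('n) * symm_sum (\<lambda>k. 1 / (norm (half_plane x - of_int k))\<^sup>2) N"
    unfolding eq symm_sum_def sum_distrib_left ..
qed

lemma potential_ge_inverse_square:
  fixes x :: "real ^ 'n"
  assumes h: "real CARD('n) * h = 1" and x: "x \<notin> poles h"
  shows "1 / (norm (x - pole h k))\<^sup>2 \<le> potential h x"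
proof -
  have "(\<Sum>\<^sub>\<infinity>k\<in>{k}. 1 / (norm (x - pole h k))\<^sup>2) \<le> potential h x"
    unfolding potential_def by (rule infsum_mono_neutral) (use potential_half_plane(1)[OF h x] in auto)
  then show ?thesis by simp
qed

lemma pole_sums_bounded_on_compact:
  fixes K :: "(real ^ 'n) set"
  assumes h: "real CARD('n) * h = 1" and K: "compact K" "K \<inter> poles h = {}"
  obtains B where "\<And>x N. x \<in> K \<Longrightarrow> symm_sum (\<lambda>k. 1 / (norm (x - pole h k))\<^sup>2) N \<le> B"
    "\<And>x N. x \<in> K \<Longrightarrow> (norm (pole_field h N x))\<^sup>2 \<le> B"
proof -
  let ?Z = "half_plane ` K"
  have cZ: "compact ?Z" using continuous_on_half_plane K(1) by (rule compact_continuous_image)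
  have "?Z \<inter> \<int> = {}" using half_plane_in_Ints[OF h] K(2) by blast
  then obtain \<delta> where d: "\<delta> > 0" "\<And>z w. z \<in> ?Z \<Longrightarrow> w \<in> \<int> \<Longrightarrow> \<delta> \<le> dist z w"
    using separate_compact_closed[OF cZ closed_Ints] by metis
  obtain M where M: "\<And>z. z \<in> ?Z \<Longrightarrow> norm z \<le> M"
    using compact_imp_bounded[OF cZ] bounded_iff by metis
  obtain B where B: "\<And>z N. \<lbrakk>norm z \<le> M; \<And>k. \<delta> \<le> norm (z - complex_of_int k)\<rbrakk> \<Longrightarrow>
      norm (symm_sum (\<lambda>k. 1 / (z - of_int k)) N) \<le> B \<and> symm_sum (\<lambda>k. 1 / (norm (z - of_int k))\<^sup>2) N \<le> B"
    by (rule symm_sums_bounded[OF d(1), of M]) blast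
  let ?d = "real CARD('n)"
  show thesis
  proof (rule that[of "max (?d * B) (?d * B\<^sup>2)"])
    fix x N assume x: "x \<in> K"
    have "\<delta> \<le> norm (half_plane x - complex_of_int k)" for k
      using d(2)[of "half_plane x" "of_int k"] x by (simp add: dist_norm)
    with x M B have b: "norm (symm_sum (\<lambda>k. 1 / (half_plane x - of_int k)) N) \<le> B"
      "symm_sum (\<lambda>k. 1 / (norm (half_plane x - of_int k))\<^sup>2) N \<le> B" by auto
    have xp: "x \<notin> poles h" using x K(2) by auto
    have "symm_sum (\<lambda>k. 1 / (norm (x - pole h k))\<^sup>2) N \<le> ?d * B"
      unfolding potential_half_plane(4)[OF h xp] by (intro mult_left_mono b) auto
    then show "symm_sum (\<lambda>k. 1 / (norm (x - pole h k))\<^sup>2) N \<le> max (?d * B) (?d * B\<^sup>2)" by simp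
    have "(norm (pole_field h N x))\<^sup>2 \<le> ?d * B\<^sup>2"
      unfolding norm_pole_field[OF h] by (intro mult_left_mono power_mono b) auto
    then show "(norm (pole_field h N x))\<^sup>2 \<le> max (?d * B) (?d * B\<^sup>2)" by simp
  qed
qed

lemma pole_field_identity:
  fixes u :: "real ^ 'n \<Rightarrow> real"
  assumes u: "smooth u" and K: "compact K" and u0: "\<And>x. x \<notin> K \<Longrightarrow> u x = 0" and p: "K \<inter> poles h = {}"
  shows "integrable lborel (\<lambda>x. 2 * u x * (gradient u x \<bullet> pole_field h N x))"
    and "integrable lborel (\<lambda>x. symm_sum (\<lambda>k. 1 / (norm (x - pole h k))\<^sup>2) N * (u x)\<^sup>2)"
    and "(\<integral>x. 2 * u x * (gradient u x \<bullet> pole_field h N x) \<partial>lborel)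
      = - (real CARD('n) - 2) * (\<integral>x. symm_sum (\<lambda>k. 1 / (norm (x - pole h k))\<^sup>2) N * (u x)\<^sup>2 \<partial>lborel)"
proof -
  have a: "pole h k \<notin> K" for k using p by (auto simp: poles_def)
  note id = hardy_divergence_identity[OF u K u0 a]
  have 1: "2 * u x * (gradient u x \<bullet> pole_field h N x) =
     (\<Sum>k\<in>{- int N..int N}. 2 * u x * (gradient u x \<bullet> (x - pole h k)) / (norm (x - pole h k))\<^sup>2)" for x
    unfolding pole_field_def symm_sum_def inner_sum_right sum_distrib_left by (intro sum.cong) auto
  have 2: "symm_sum (\<lambda>k. 1 / (norm (x - pole h k))\<^sup>2) N * (u x)\<^sup>2
    = (\<Sum>k\<in>{- int N..int N}. (u x)\<^sup>2 / (norm (x - pole h k))\<^sup>2)" for x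
    unfolding symm_sum_def sum_distrib_right by (intro sum.cong) auto
  show "integrable lborel (\<lambda>x. 2 * u x * (gradient u x \<bullet> pole_field h N x))"
    "integrable lborel (\<lambda>x. symm_sum (\<lambda>k. 1 / (norm (x - pole h k))\<^sup>2) N * (u x)\<^sup>2)"
    unfolding 1 2 by (intro Bochner_Integration.integrable_sum id; assumption)+
  show "(\<integral>x. 2 * u x * (gradient u x \<bullet> pole_field h N x) \<partial>lborel)
      = - (real CARD('n) - 2) * (\<integral>x. symm_sum (\<lambda>k. 1 / (norm (x - pole h k))\<^sup>2) N * (u x)\<^sup>2 \<partial>lborel)"
    unfolding 1 2
    by (subst (1 2) Bochner_Integration.integral_sum) (auto intro: id(1,2) u0 simp: id(3) sum_distrib_left)
qed


lemma hardy_inequality_cylinder: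
  fixes u :: "real ^ 'n \<Rightarrow> real"
  assumes h: "real CARD('n) * h = 1" and R: "R > 0"
    and u: "smooth u" and K: "compact K" and u0: "\<And>x. x \<notin> K \<Longrightarrow> u x = 0"
    and p: "K \<inter> poles h = {}" and cyl: "K \<subseteq> cylinder R"
  defines "Y \<equiv> pi * R * sqrt (real CARD('n)) * coth (pi * R * sqrt (real CARD('n)))"
  shows "integrable lborel (\<lambda>x. (norm (gradient u x))\<^sup>2)"
    and "integrable lborel (\<lambda>x. potential h x * (u x)\<^sup>2)"
    and "(real CARD('n) - 2)\<^sup>2 / (4 * Y) * (\<integral>x. potential h x * (u x)\<^sup>2 \<partial>lborel)
      \<le> (\<integral>x. (norm (gradient u x))\<^sup>2 \<partial>lborel)"
proof -
  let ?d = "real CARD('n)"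
  let ?V = "\<lambda>N x. symm_sum (\<lambda>k. 1 / (norm (x - pole h k))\<^sup>2) N"
  let ?T = "pole_field h :: nat \<Rightarrow> real ^ 'n \<Rightarrow> real ^ 'n"
  let ?T2 = "\<lambda>x. ?d * (norm (of_real pi * cot (of_real pi * half_plane x)))\<^sup>2"
  \<comment> \<open>This value maximises \<open>c (d - 2) - c\<^sup>2 Y\<close>.\<close>
  define c where "c = (?d - 2) / (2 * Y)"
  obtain B where B: "\<And>x N. x \<in> K \<Longrightarrow> ?V N x \<le> B" "\<And>x N. x \<in> K \<Longrightarrow> (norm (?T N x))\<^sup>2 \<le> B"
    by (rule pole_sums_bounded_on_compact[OF h K p]) blast
  have oK: "open (- K)" using K by (simp add: compact_imp_closed open_Compl)
  have g0: "gradient u x = 0" if "x \<notin> K" for x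
    by (rule gradient_eq_0[OF u oK]) (use that u0 in auto)
  note cont = smooth_continuous[OF u] smooth_continuous_gradient[OF u]
  have contT: "continuous_on K (?T N)" for N
    unfolding pole_field_def symm_sum_def using p
    by (intro continuous_intros) (auto simp: poles_def)
  show int_g: "integrable lborel (\<lambda>x. (norm (gradient u x))\<^sup>2)"
    using K by (rule integrable_compact_support) (use g0 in \<open>auto intro!: continuous_intros cont\<close>)
  have int_u: "integrable lborel (\<lambda>x. B * (u x)\<^sup>2)"
    using K by (rule integrable_compact_support) (use u0 in \<open>auto intro!: continuous_intros cont\<close>)
  have int_T: "integrable lborel (\<lambda>x. (norm (?T N x))\<^sup>2 * (u x)\<^sup>2)" for N
    using K by (rule integrable_compact_support) (use u0 in \<open>auto intro!: continuous_intros cont contT\<close>)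
  note id = pole_field_identity[OF u K u0 p]
  have V_nonneg: "?V N x \<ge> 0" for N x unfolding symm_sum_def by (intro sum_nonneg) auto
  have limV: "(\<lambda>N. ?V N x * (u x)\<^sup>2) \<longlonglongrightarrow> potential h x * (u x)\<^sup>2" for x
  proof (cases "x \<in> K")
    case True
    with p have "x \<notin> poles h" by auto
    then show ?thesis by (intro tendsto_intros potential_half_plane(3) h)
  qed (simp add: u0)
  have limT: "(\<lambda>N. (norm (?T N x))\<^sup>2 * (u x)\<^sup>2) \<longlonglongrightarrow> ?T2 x * (u x)\<^sup>2" for x
  proof (cases "x \<in> K")
    case True
    with p have "x \<notin> poles h" by auto
    then have "half_plane x \<notin> \<int>" using half_plane_in_Ints[OF h] by blast
    then show ?thesis unfolding norm_pole_field[OF h]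
      by (intro tendsto_intros pi_cot_partial_fractions)
  qed (simp add: u0)
  have domV: "norm (?V N x * (u x)\<^sup>2) \<le> B * (u x)\<^sup>2" for N x
  proof (cases "x \<in> K")
    case True
    have "0 \<le> ?V N x" by (rule V_nonneg)
    with B(1)[OF True, of N] show ?thesis by (simp add: mult_right_mono)
  qed (simp add: u0)
  have domT: "norm ((norm (?T N x))\<^sup>2 * (u x)\<^sup>2) \<le> B * (u x)\<^sup>2" for N x
  proof (cases "x \<in> K")
    case True
    with B(2)[OF True, of N] show ?thesis by (simp add: mult_right_mono)
  qed (simp add: u0)
  have measV: "(\<lambda>x. potential h x * (u x)\<^sup>2) \<in> borel_measurable lborel"
    by (rule borel_measurable_LIMSEQ_real[OF limV]) (use id(2) in blast)
  have measT: "(\<lambda>x. ?T2 x * (u x)\<^sup>2) \<in> borel_measurable lborel"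
    by (rule borel_measurable_LIMSEQ_real[OF limT]) (use int_T in blast)
  have measVN: "(\<lambda>x. ?V N x * (u x)\<^sup>2) \<in> borel_measurable lborel" for N
    using id(2) by blast
  have measTN: "(\<lambda>x. (norm (?T N x))\<^sup>2 * (u x)\<^sup>2) \<in> borel_measurable lborel" for N
    using int_T by blast
  show int_V: "integrable lborel (\<lambda>x. potential h x * (u x)\<^sup>2)"
    by (rule integrable_dominated_convergence[OF measV measVN int_u AE_I2[OF limV] AE_I2[OF domV]])
  have convV: "(\<lambda>N. \<integral>x. ?V N x * (u x)\<^sup>2 \<partial>lborel) \<longlonglongrightarrow> (\<integral>x. potential h x * (u x)\<^sup>2 \<partial>lborel)"
    by (rule integral_dominated_convergence[OF measV measVN int_u AE_I2[OF limV] AE_I2[OF domV]])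
  have int_T2: "integrable lborel (\<lambda>x. ?T2 x * (u x)\<^sup>2)"
    by (rule integrable_dominated_convergence[OF measT measTN int_u AE_I2[OF limT] AE_I2[OF domT]])
  have convT: "(\<lambda>N. \<integral>x. (norm (?T N x))\<^sup>2 * (u x)\<^sup>2 \<partial>lborel) \<longlonglongrightarrow> (\<integral>x. ?T2 x * (u x)\<^sup>2 \<partial>lborel)"
    by (rule integral_dominated_convergence[OF measT measTN int_u AE_I2[OF limT] AE_I2[OF domT]])
  let ?E = "\<integral>x. (norm (gradient u x))\<^sup>2 \<partial>lborel"
  have energy_N: "c * (?d - 2) * (\<integral>x. ?V N x * (u x)\<^sup>2 \<partial>lborel) - c\<^sup>2 * (\<integral>x. (norm (?T N x))\<^sup>2 * (u x)\<^sup>2 \<partial>lborel) \<le> ?E" for N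
  proof -
    have "0 \<le> (\<integral>x. (norm (gradient u x + (c * u x) *\<^sub>R ?T N x))\<^sup>2 \<partial>lborel)" by simp
    also have "(\<lambda>x. (norm (gradient u x + (c * u x) *\<^sub>R ?T N x))\<^sup>2)
      = (\<lambda>x. (norm (gradient u x))\<^sup>2 + c * (2 * u x * (gradient u x \<bullet> ?T N x)) + c\<^sup>2 * ((norm (?T N x))\<^sup>2 * (u x)\<^sup>2))"
      unfolding power2_norm_eq_inner
      by (auto simp: fun_eq_iff inner_add_left inner_add_right inner_commute power2_eq_square)
    also have "(\<integral>x. \<dots> x \<partial>lborel) = ?E + c * (\<integral>x. 2 * u x * (gradient u x \<bullet> ?T N x) \<partial>lborel)
        + c\<^sup>2 * (\<integral>x. (norm (?T N x))\<^sup>2 * (u x)\<^sup>2 \<partial>lborel)"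
    proof -
      have "integrable lborel (\<lambda>x. 2 * u x * (gradient u x \<bullet> ?T N x))" by (rule id(1))
      then have "integrable lborel (\<lambda>x. c * (2 * u x * (gradient u x \<bullet> ?T N x)))"
        by (rule integrable_mult_right)
      moreover have "integrable lborel (\<lambda>x. c\<^sup>2 * ((norm (?T N x))\<^sup>2 * (u x)\<^sup>2))"
        by (rule integrable_mult_right[OF int_T])
      ultimately show ?thesis using int_g by simp
    qed
    also have "(\<integral>x. 2 * u x * (gradient u x \<bullet> ?T N x) \<partial>lborel) = - (?d - 2) * (\<integral>x. ?V N x * (u x)\<^sup>2 \<partial>lborel)"
      by (rule id(3))
    finally show ?thesis by (simp add: algebra_simps)
  qed
  have Y1: "Y \<ge> 1" unfolding Y_def by (intro x_coth_ge_1) (use R in simp)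
  have "c * (?d - 2) * (\<integral>x. potential h x * (u x)\<^sup>2 \<partial>lborel) - c\<^sup>2 * (\<integral>x. ?T2 x * (u x)\<^sup>2 \<partial>lborel) \<le> ?E"
  proof (rule LIMSEQ_le_const2)
    show "(\<lambda>N. c * (?d - 2) * (\<integral>x. ?V N x * (u x)\<^sup>2 \<partial>lborel) - c\<^sup>2 * (\<integral>x. (norm (?T N x))\<^sup>2 * (u x)\<^sup>2 \<partial>lborel))
      \<longlonglongrightarrow> c * (?d - 2) * (\<integral>x. potential h x * (u x)\<^sup>2 \<partial>lborel) - c\<^sup>2 * (\<integral>x. ?T2 x * (u x)\<^sup>2 \<partial>lborel)"
      by (intro tendsto_intros convV convT)
  qed (use energy_N in blast)
  moreover have "(\<integral>x. ?T2 x * (u x)\<^sup>2 \<partial>lborel) \<le> (\<integral>x. Y * (potential h x * (u x)\<^sup>2) \<partial>lborel)"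
  proof (rule integral_mono)
    fix x
    show "?T2 x * (u x)\<^sup>2 \<le> Y * (potential h x * (u x)\<^sup>2)"
    proof (cases "x \<in> K")
      case True
      with p have xp: "x \<notin> poles h" by auto
      then have z: "half_plane x \<notin> \<int>" using half_plane_in_Ints[OF h] by blast
      have "(norm (of_real pi * cot (of_real pi * half_plane x)))\<^sup>2
        \<le> Y * (\<Sum>\<^sub>\<infinity>k. 1 / (norm (half_plane x - of_int k))\<^sup>2)"
        unfolding Y_def mult.assoc[of pi R]
      proof (rule pi_cot_norm_le[OF z])
        show "0 \<le> Im (half_plane x)" by (simp add: half_plane_def)
        show "Im (half_plane x) \<le> R * sqrt ?d" using True cyl by (intro Im_half_plane_cylinder) auto
      qed (use R in simp)
      then have "?T2 x \<le> ?d * (Y * (\<Sum>\<^sub>\<infinity>k. 1 / (norm (half_plane x - of_int k))\<^sup>2))"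
        by (intro mult_left_mono) auto
      also have "\<dots> = Y * potential h x" unfolding potential_half_plane(2)[OF h xp] by simp
      finally show ?thesis by (simp add: mult_right_mono mult.assoc[symmetric])
    qed (simp add: u0)
  qed (use int_V int_T2 in auto)
  then have "c\<^sup>2 * (\<integral>x. ?T2 x * (u x)\<^sup>2 \<partial>lborel) \<le> c\<^sup>2 * (Y * (\<integral>x. potential h x * (u x)\<^sup>2 \<partial>lborel))"
    by (intro mult_left_mono) auto
  ultimately have "(c * (?d - 2) - c\<^sup>2 * Y) * (\<integral>x. potential h x * (u x)\<^sup>2 \<partial>lborel) \<le> ?E"
    by (simp add: algebra_simps)
  moreover have "c * (?d - 2) - c\<^sup>2 * Y = (?d - 2)\<^sup>2 / (4 * Y)"
    using Y1 by (simp add: c_def power2_eq_square field_simps)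
  ultimately show "(?d - 2)\<^sup>2 / (4 * Y) * (\<integral>x. potential h x * (u x)\<^sup>2 \<partial>lborel) \<le> ?E" by simp
qed

lemma integral_pos_if_continuous:
  fixes u f :: "'a::euclidean_space \<Rightarrow> real"
  assumes c: "continuous_on UNIV u" and nz: "u y \<noteq> 0" and int: "integrable lborel f"
    and nonneg: "\<And>x. f x \<ge> 0" and pos: "\<And>x. u x \<noteq> 0 \<Longrightarrow> f x > 0"
  shows "(\<integral>x. f x \<partial>lborel) > 0"
proof (rule ccontr)
  assume "\<not> ?thesis"
  moreover have "(\<integral>x. f x \<partial>lborel) \<ge> 0" by (intro Bochner_Integration.integral_nonneg nonneg)
  ultimately have "(\<integral>x. f x \<partial>lborel) = 0" by simp
  then have "AE x in lborel. f x = 0"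
    using int nonneg by (subst (asm) integral_nonneg_eq_0_iff_AE) auto
  then have ae: "AE x in lborel. x \<notin> {x. u x \<noteq> 0}" by eventually_elim (use pos in force)
  have op: "open {x. u x \<noteq> 0}"
    using open_Collect_neq[OF c continuous_on_const[of UNIV 0]] .
  then have "{x. u x \<noteq> 0} \<in> null_sets lborel"
    using ae by (subst AE_iff_null_sets) auto
  then have "negligible {x. u x \<noteq> 0}"
    using negligible_iff_null_sets null_sets_completionI by blast
  then show False using open_not_negligible[OF op] nz by blast
qed

lemma potential_nonneg: "potential h x \<ge> 0"
  unfolding potential_def by (intro infsum_nonneg) auto

text \<open>
  Facts about an admissible function: the integrals in its Rayleigh quotient may be taken over the whole
  space, and the denominator is positive.
\<close>

lemma test_function_facts:
  fixes u :: "real ^ 'n \<Rightarrow> real"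
  assumes h: "real CARD('n) * h = 1" and u: "u \<in> test_functions (interior (cylinder R) - poles h) - {\<lambda>x. 0}"
  defines "K \<equiv> closure {x. u x \<noteq> 0}"
  shows "smooth u" "compact K" "\<And>x. x \<notin> K \<Longrightarrow> u x = 0" "K \<inter> poles h = {}" "K \<subseteq> cylinder R"
    and "(LINT x:cylinder R|lborel. (norm (gradient u x))\<^sup>2) = (\<integral>x. (norm (gradient u x))\<^sup>2 \<partial>lborel)"
    and "(LINT x:cylinder R|lborel. potential h x * (u x)\<^sup>2) = (\<integral>x. potential h x * (u x)\<^sup>2 \<partial>lborel)"
    and "R > 0 \<Longrightarrow> (\<integral>x. potential h x * (u x)\<^sup>2 \<partial>lborel) > 0"
proof -
  show s: "smooth u" and K: "compact K"
    using u by (simp_all add: test_functions_def K_def)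
  have sub: "K \<subseteq> interior (cylinder R) - poles h"
    using u by (simp add: test_functions_def K_def)
  then show p: "K \<inter> poles h = {}" by auto
  have "interior (cylinder R) - poles h \<subseteq> cylinder R" using interior_subset by auto
  with sub show cyl: "K \<subseteq> cylinder R" by (rule subset_trans)
  show u0: "x \<notin> K \<Longrightarrow> u x = 0" for x
    using closure_subset[of "{x. u x \<noteq> 0}"] unfolding K_def by auto
  have oK: "open (- K)" using K by (simp add: compact_imp_closed open_Compl)
  have g0: "gradient u x = 0" if "x \<notin> K" for x
    by (rule gradient_eq_0[OF s oK]) (use that u0 in auto)
  show "(LINT x:cylinder R|lborel. (norm (gradient u x))\<^sup>2) = (\<integral>x. (norm (gradient u x))\<^sup>2 \<partial>lborel)"
    unfolding set_lebesgue_integral_def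
    by (intro Bochner_Integration.integral_cong) (use g0 cyl in \<open>auto simp: indicator_def\<close>)
  show "(LINT x:cylinder R|lborel. potential h x * (u x)\<^sup>2) = (\<integral>x. potential h x * (u x)\<^sup>2 \<partial>lborel)"
    unfolding set_lebesgue_integral_def
    by (intro Bochner_Integration.integral_cong) (use u0 cyl in \<open>auto simp: indicator_def\<close>)
  assume R: "R > 0"
  from u obtain y where "u y \<noteq> 0" by auto
  then show "(\<integral>x. potential h x * (u x)\<^sup>2 \<partial>lborel) > 0"
  proof (rule integral_pos_if_continuous[OF smooth_continuous[OF s]])
    show "integrable lborel (\<lambda>x. potential h x * (u x)\<^sup>2)"
      by (rule hardy_inequality_cylinder(2)[OF h R s K u0 p cyl])
    fix x
    show "0 \<le> potential h x * (u x)\<^sup>2" by (simp add: potential_nonneg)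
    assume ux: "u x \<noteq> 0"
    then have xp: "x \<notin> poles h" using u0 p by blast
    then have "x \<noteq> pole h 0" by (auto simp: poles_def)
    then have "0 < 1 / (norm (x - pole h 0))\<^sup>2" by simp
    also have "\<dots> \<le> potential h x" by (rule potential_ge_inverse_square[OF h xp])
    finally show "0 < potential h x * (u x)\<^sup>2" using ux by simp
  qed
qed

section \<open>Smooth functions of the logarithm of the radius\<close>

text \<open>
  The functions \<open>exp (- 1 / t) / t\<^sup>m\<close>, extended by zero to \<open>t \<le> 0\<close>. Their span is closed under
  differentiation, also at \<open>0\<close>; this is the source of all smoothness below.
\<close>

definition flat_exp :: "nat \<Rightarrow> real \<Rightarrow> real"
  where "flat_exp m t = (if t > 0 then exp (- 1 / t) / t ^ m else 0)"

lemma flat_exp_nonneg: "flat_exp m t \<ge> 0"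
  by (simp add: flat_exp_def)

lemma flat_exp_tendsto_0: "(flat_exp m \<longlongrightarrow> 0) (at 0)"
proof -
  have "((\<lambda>y. y ^ m / exp y) \<longlongrightarrow> (0::real)) at_top" by (rule tendsto_power_div_exp_0)
  moreover have "\<forall>\<^sub>F y in at_top. y ^ m / exp y = flat_exp m (inverse y)"
    using eventually_gt_at_top[of "0::real"]
    by eventually_elim (simp add: flat_exp_def field_simps exp_minus power_inverse)
  ultimately have "((\<lambda>y. flat_exp m (inverse y)) \<longlongrightarrow> 0) at_top"
    by (rule Lim_transform_eventually)
  then have "(flat_exp m \<longlongrightarrow> 0) (at_right 0)"
    by (simp add: filterlim_at_right_to_top)
  moreover have "(flat_exp m \<longlongrightarrow> 0) (at_left 0)"
    by (rule tendsto_eventually) (auto simp: eventually_at_filter flat_exp_def)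
  ultimately show ?thesis by (simp add: filterlim_split_at)
qed

lemma flat_exp_deriv:
  "(flat_exp m has_real_derivative flat_exp (m + 2) t - real m * flat_exp (m + 1) t) (at t)"
proof -
  consider "t > 0" | "t = 0" | "t < 0" by linarith
  then show ?thesis
  proof cases
    case 1
    have "((\<lambda>t. exp (- 1 / t) / t ^ m) has_real_derivative
        flat_exp (m + 2) t - real m * flat_exp (m + 1) t) (at t)"
    proof (cases m)
      case 0
      then show ?thesis using 1
        by (auto intro!: derivative_eq_intros simp: flat_exp_def power2_eq_square)
    next
      case (Suc n)
      then show ?thesis using 1
        by (auto intro!: derivative_eq_intros simp: flat_exp_def)
          (cases n; simp add: field_simps power2_eq_square)
    qed
    then show ?thesis
      by (rule has_field_derivative_transform_within_open[where S = "{0<..}"]) (use 1 in \<open>auto simp: flat_exp_def\<close>)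
  next
    case 2
    have "((\<lambda>y. (flat_exp m y - flat_exp m 0) / (y - 0)) \<longlongrightarrow> 0) (at 0)"
      by (rule Lim_transform_eventually[OF flat_exp_tendsto_0[of "m + 1"]])
        (auto simp: flat_exp_def eventually_at_filter mult.commute)
    then show ?thesis using 2 by (simp add: has_field_derivative_iff flat_exp_def)
  next
    case 3
    have "((\<lambda>_. 0) has_real_derivative flat_exp (m + 2) t - real m * flat_exp (m + 1) t) (at t)"
      using 3 by (simp add: flat_exp_def)
    then show ?thesis
      by (rule has_field_derivative_transform_within_open[where S = "{..<0}"]) (use 3 in \<open>auto simp: flat_exp_def\<close>)
  qed
qed

lemma flat_exp_0_le_1: "flat_exp 0 t \<le> 1"
  by (simp add: flat_exp_def)

lemma flat_exp_2_le_2: "flat_exp 2 t \<le> 2"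
proof (cases "t > 0")
  case True
  then have "1 + 1 / t + (1 / t)\<^sup>2 / 2 \<le> exp (1 / t)" by (intro exp_lower_Taylor_quadratic) simp
  moreover have "1 / t > 0" using True by simp
  ultimately have "(1 / t)\<^sup>2 \<le> 2 * exp (1 / t)" by linarith
  then show ?thesis using True
    by (simp add: flat_exp_def exp_minus field_simps)
qed (simp add: flat_exp_def)

lemma flat_exp_0_lower: "1 / 4 \<le> t \<Longrightarrow> exp (- 4) \<le> flat_exp 0 t"
  by (simp add: flat_exp_def field_simps)

text \<open>
  A power of \<open>q\<close> times a bump in \<open>s = log q / (2 L)\<close> that lives on \<open>-2 < s < -1\<close>. For \<open>q = |x|\<^sup>2\<close> this is
  \<open>s = log |x| / L\<close>. The indices \<open>m\<close> and \<open>k\<close> make the family closed under differentiation.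
\<close>

definition log_bump :: "real \<Rightarrow> real \<Rightarrow> nat \<Rightarrow> nat \<Rightarrow> real \<Rightarrow> real"
  where "log_bump L a m k q =
    (if q > 0 then q powr a * flat_exp m (ln q / (2 * L) + 2) * flat_exp k (- 1 - ln q / (2 * L)) else 0)"

text \<open>
  The derivative of \<^const>\<open>log_bump\<close> in its last argument, for \<open>L > 0\<close>.
\<close>

definition log_bump' :: "real \<Rightarrow> real \<Rightarrow> nat \<Rightarrow> nat \<Rightarrow> real \<Rightarrow> real"
  where "log_bump' L a m k q = a * log_bump L (a - 1) m k q
    + 1 / (2 * L) * (log_bump L (a - 1) (m + 2) k q - real m * log_bump L (a - 1) (m + 1) k q)
    - 1 / (2 * L) * (log_bump L (a - 1) m (k + 2) q - real k * log_bump L (a - 1) m (k + 1) q)"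

lemma log_bump_deriv:
  assumes L: "L > 0"
  shows "(log_bump L a m k has_real_derivative log_bump' L a m k q) (at q)"
proof (cases "q > 0")
  case True
  have "((\<lambda>q. q powr a * flat_exp m (ln q / (2 * L) + 2) * flat_exp k (- 1 - ln q / (2 * L)))
      has_real_derivative log_bump' L a m k q) (at q)"
    using True L
    by (auto intro!: derivative_eq_intros DERIV_chain2[OF flat_exp_deriv]
        simp: log_bump'_def log_bump_def powr_diff)
       (simp add: field_simps)
  then show ?thesis
    by (rule has_field_derivative_transform_within_open[where S = "{0<..}"]) (use True in \<open>auto simp: log_bump_def\<close>)
next
  case False
  \<comment> \<open>The bump vanishes on a neighbourhood of \<open>q \<le> 0\<close>, which removes the singularity of the logarithm.\<close>
  have zero: "log_bump L a m k q = 0" if "q < exp (- 4 * L)" for q m k a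
  proof (cases "q > 0")
    case True
    with that have "ln q < - 4 * L" by (metis exp_less_cancel_iff exp_ln)
    then show ?thesis using L by (simp add: log_bump_def flat_exp_def field_simps)
  qed (simp add: log_bump_def)
  have q: "q < exp (- 4 * L)" using False by (meson exp_gt_zero le_less_trans not_less)
  have "((\<lambda>_. 0) has_real_derivative log_bump' L a m k q) (at q)"
    using zero[OF q] by (simp add: log_bump'_def)
  then show ?thesis
    by (rule has_field_derivative_transform_within_open[where S = "{..<exp (- 4 * L)}"]) (use q zero in auto)
qed

text \<open>
  The algebra generated by the coordinates and the radial functions \<open>log_bump L a m k |x|\<^sup>2\<close>. It is closed under
  partial derivatives, so all its elements are smooth.
\<close>

inductive_set bump_algebra :: "real \<Rightarrow> (real ^ 'n \<Rightarrow> real) set" for L where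
  const: "(\<lambda>x. c) \<in> bump_algebra L"
| coord: "(\<lambda>x. x $ i) \<in> bump_algebra L"
| bump: "(\<lambda>x. log_bump L a m k (x \<bullet> x)) \<in> bump_algebra L"
| add: "f \<in> bump_algebra L \<Longrightarrow> g \<in> bump_algebra L \<Longrightarrow> (\<lambda>x. f x + g x) \<in> bump_algebra L"
| mult: "f \<in> bump_algebra L \<Longrightarrow> g \<in> bump_algebra L \<Longrightarrow> (\<lambda>x. f x * g x) \<in> bump_algebra L"

lemma bump_algebra_log_bump': "(\<lambda>x. log_bump' L a m k (x \<bullet> x)) \<in> bump_algebra L"
proof -
  have "(\<lambda>x. a * log_bump L (a - 1) m k (x \<bullet> x)
    + (1 / (2 * L) * (log_bump L (a - 1) (m + 2) k (x \<bullet> x) + - real m * log_bump L (a - 1) (m + 1) k (x \<bullet> x))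
    + - 1 / (2 * L) * (log_bump L (a - 1) m (k + 2) (x \<bullet> x) + - real k * log_bump L (a - 1) m (k + 1) (x \<bullet> x))))
     \<in> bump_algebra L"
    by (intro bump_algebra.intros)
  also have "(\<lambda>x :: real ^ 'a. a * log_bump L (a - 1) m k (x \<bullet> x)
    + (1 / (2 * L) * (log_bump L (a - 1) (m + 2) k (x \<bullet> x) + - real m * log_bump L (a - 1) (m + 1) k (x \<bullet> x))
    + - 1 / (2 * L) * (log_bump L (a - 1) m (k + 2) (x \<bullet> x) + - real k * log_bump L (a - 1) m (k + 1) (x \<bullet> x))))
    = (\<lambda>x. log_bump' L a m k (x \<bullet> x))"
    by (simp add: log_bump'_def fun_eq_iff)
  finally show ?thesis .
qed

lemma log_bump_inner_deriv:
  fixes x :: "real ^ 'n"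
  assumes L: "L > 0"
  shows "((\<lambda>x. log_bump L a m k (x \<bullet> x)) has_derivative
     (\<lambda>v. ((2 * log_bump' L a m k (x \<bullet> x)) *\<^sub>R x) \<bullet> v)) (at x)"
proof -
  have "((\<lambda>x. x \<bullet> x) has_derivative (\<lambda>v. 2 * (x \<bullet> v))) (at x)"
    by (auto intro!: derivative_eq_intros simp: fun_eq_iff inner_commute)
  from has_derivative_compose[OF this log_bump_deriv[OF L, unfolded has_field_derivative_def]]
  show ?thesis by (simp add: mult_ac)
qed

lemma bump_algebra_deriv:
  fixes f :: "real ^ 'n \<Rightarrow> real"
  assumes L: "L > 0" and f: "f \<in> bump_algebra L"
  shows "\<exists>g. (\<forall>i. (\<lambda>x. g x $ i) \<in> bump_algebra L) \<and> (\<forall>x. (f has_derivative (\<lambda>v. g x \<bullet> v)) (at x))"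
  using f
proof induction
  case (const c)
  show ?case by (intro exI[of _ "\<lambda>x. 0"]) (auto intro: bump_algebra.const)
next
  case (coord i)
  have "(\<lambda>x::real ^ 'n. (axis i 1 :: real ^ 'n) $ j) \<in> bump_algebra L" for j
    by (rule bump_algebra.const)
  moreover have "((\<lambda>x::real ^ 'n. x $ i) has_derivative (\<lambda>v. axis i 1 \<bullet> v)) (at x)" for x
    using bounded_linear_imp_has_derivative[OF bounded_linear_vec_nth] by (simp add: inner_axis')
  ultimately show ?case by (intro exI[of _ "\<lambda>x. axis i 1"]) blast
next
  case (bump a m k)
  have "(\<lambda>x::real ^ 'n. 2 * log_bump' L a m k (x \<bullet> x) * x $ i) \<in> bump_algebra L" for i
    by (intro bump_algebra.mult bump_algebra.const bump_algebra_log_bump' bump_algebra.coord)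
  then show ?case
    by (intro exI[of _ "\<lambda>x. (2 * log_bump' L a m k (x \<bullet> x)) *\<^sub>R x"] conjI allI log_bump_inner_deriv[OF L])
      simp
next
  case (add f1 f2)
  then obtain g1 g2 where g: "\<And>i. (\<lambda>x. g1 x $ i) \<in> bump_algebra L" "\<And>i. (\<lambda>x. g2 x $ i) \<in> bump_algebra L"
    "\<And>x. (f1 has_derivative (\<lambda>v. g1 x \<bullet> v)) (at x)" "\<And>x. (f2 has_derivative (\<lambda>v. g2 x \<bullet> v)) (at x)" by blast
  have "(\<lambda>x. (g1 x + g2 x) $ i) \<in> bump_algebra L" for i
    unfolding vector_add_component by (intro bump_algebra.add g)
  moreover have "((\<lambda>x. f1 x + f2 x) has_derivative (\<lambda>v. (g1 x + g2 x) \<bullet> v)) (at x)" for x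
    unfolding inner_add_left by (intro has_derivative_add g)
  ultimately show ?case by (intro exI[of _ "\<lambda>x. g1 x + g2 x"]) blast
next
  case (mult f1 f2)
  then obtain g1 g2 where g: "\<And>i. (\<lambda>x. g1 x $ i) \<in> bump_algebra L" "\<And>i. (\<lambda>x. g2 x $ i) \<in> bump_algebra L"
    "\<And>x. (f1 has_derivative (\<lambda>v. g1 x \<bullet> v)) (at x)" "\<And>x. (f2 has_derivative (\<lambda>v. g2 x \<bullet> v)) (at x)" by blast
  have "(\<lambda>x. (f1 x *\<^sub>R g2 x + f2 x *\<^sub>R g1 x) $ i) \<in> bump_algebra L" for i
    unfolding vector_add_component vector_scaleR_component real_scaleR_def
    by (intro bump_algebra.add bump_algebra.mult g mult.hyps)
  moreover have "((\<lambda>x. f1 x * f2 x) has_derivative (\<lambda>v. (f1 x *\<^sub>R g2 x + f2 x *\<^sub>R g1 x) \<bullet> v)) (at x)" for x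
    using has_derivative_mult[OF g(3)[of x] g(4)[of x]]
    by (simp add: inner_add_left mult.commute add.commute)
  ultimately show ?case by (intro exI[of _ "\<lambda>x. f1 x *\<^sub>R g2 x + f2 x *\<^sub>R g1 x"]) blast
qed

lemma partial_deriv_eq:
  assumes "(f has_derivative (\<lambda>v. g \<bullet> v)) (at x)"
  shows "partial_deriv i f x = g $ i"
proof -
  have "frechet_derivative f (at x) (axis i 1) = g \<bullet> axis i 1"
    using frechet_derivative_at[OF assms] by metis
  then show ?thesis by (simp add: partial_deriv_def inner_axis)
qed

lemma bump_algebra_smooth:
  fixes f :: "real ^ 'n \<Rightarrow> real"
  assumes L: "L > 0" and f: "f \<in> bump_algebra L"
  shows "smooth f"
proof -
  have "times_cont_diff m f" for m
    using f
  proof (induction m arbitrary: f)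
    case 0
    then obtain g where "\<And>x. (f has_derivative (\<lambda>v. g x \<bullet> v)) (at x)"
      using bump_algebra_deriv[OF L] by blast
    then show ?case
      by (auto intro!: continuous_at_imp_continuous_on has_derivative_continuous)
  next
    case (Suc m)
    then obtain g where g: "\<And>i. (\<lambda>x. g x $ i) \<in> bump_algebra L" "\<And>x. (f has_derivative (\<lambda>v. g x \<bullet> v)) (at x)"
      using bump_algebra_deriv[OF L Suc.prems] by blast
    have "partial_deriv i f = (\<lambda>x. g x $ i)" for i
      using partial_deriv_eq[OF g(2)] by (simp add: fun_eq_iff)
    then show ?case using Suc.IH[OF g(1)] g(2) by (auto simp: differentiable_def)
  qed
  then show ?thesis by (simp add: smooth_def)
qed

section \<open>Almost extremal functions for one pole\<close>

text \<open>
  The shell \<open>e\<^bsup>-(j + 1)\<^esup> \<le> |x| < e\<^bsup>-j\<^esup>\<close>. In the form with the ceiling, disjointness of different shells is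
  immediate.
\<close>

definition shell :: "nat \<Rightarrow> 'a::euclidean_space set"
  where "shell j = {x. x \<noteq> 0 \<and> \<lceil>- ln (norm x)\<rceil> = int j + 1}"

lemma shell_iff: "x \<in> shell j \<longleftrightarrow> exp (- (real j + 1)) \<le> norm x \<and> norm x < exp (- real j)"
proof (cases "x = 0")
  case False
  then have n: "norm x > 0" by simp
  have "x \<in> shell j \<longleftrightarrow> real j < - ln (norm x) \<and> - ln (norm x) \<le> real j + 1"
    using False by (auto simp: shell_def ceiling_eq_iff)
  also have "\<dots> \<longleftrightarrow> ln (norm x) < - real j \<and> - (real j + 1) \<le> ln (norm x)" by auto
  also have "\<dots> \<longleftrightarrow> norm x < exp (- real j) \<and> exp (- (real j + 1)) \<le> norm x"
    using n by (metis exp_less_cancel_iff exp_le_cancel_iff exp_ln)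
  finally show ?thesis by blast
qed (simp add: shell_def)

lemma shell_eq: "shell j = ball 0 (exp (- real j)) - ball 0 (exp (- (real j + 1)))"
  by (auto simp: shell_iff)

lemma measure_shell:
  "measure lborel (shell j :: 'a::euclidean_space set)
    = measure lborel (ball 0 1 :: 'a set) * (exp (- (real j * DIM('a))) - exp (- ((real j + 1) * DIM('a))))"
proof -
  have ball: "measure lborel (ball 0 (exp (- r)) :: 'a set) = measure lborel (ball 0 1 :: 'a set) * exp (- (r * DIM('a)))" for r
    by (simp add: content_ball exp_of_nat2_mult[symmetric])
  have "measure lborel (shell j :: 'a set)
    = measure lborel (ball 0 (exp (- real j)) :: 'a set) - measure lborel (ball 0 (exp (- (real j + 1))) :: 'a set)"
    unfolding shell_eq
    by (rule measure_Diff) (use emeasure_bounded_finite[OF bounded_ball[of "0 :: 'a" "exp (- real j)"]] in \<open>auto intro!: subset_ball\<close>)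
  then show ?thesis unfolding ball by (simp add: right_diff_distrib)
qed

lemma integrable_shell: "integrable lborel (indicator (shell j :: 'a::euclidean_space set) :: 'a \<Rightarrow> real)"
proof (rule integrable_real_indicator)
  have "bounded (shell j :: 'a set)" by (auto simp: shell_eq intro: bounded_subset[OF bounded_ball])
  then show "emeasure lborel (shell j :: 'a set) < \<infinity>" by (rule emeasure_bounded_finite)
qed (simp add: shell_eq)

lemma integral_weighted_shells:
  fixes w :: "nat \<Rightarrow> real"
  assumes "finite J"
  shows "integrable lborel (\<lambda>x::'a::euclidean_space. \<Sum>j\<in>J. w j * indicator (shell j) x)"
    and "integral\<^sup>L lborel (\<lambda>x::'a. \<Sum>j\<in>J. w j * indicator (shell j) x) = (\<Sum>j\<in>J. w j * measure lborel (shell j :: 'a set))"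
proof -
  show "integrable lborel (\<lambda>x::'a::euclidean_space. \<Sum>j\<in>J. w j * indicator (shell j) x)"
    by (intro Bochner_Integration.integrable_sum integrable_mult_right integrable_shell)
  show "integral\<^sup>L lborel (\<lambda>x::'a. \<Sum>j\<in>J. w j * indicator (shell j) x) = (\<Sum>j\<in>J. w j * measure lborel (shell j :: 'a set))"
    by (subst Bochner_Integration.integral_sum) (simp_all add: integrable_mult_right integrable_shell)
qed

lemma shell_sum_eq:
  assumes "finite J" "x \<in> shell j" "j \<in> J"
  shows "(\<Sum>j\<in>J. w j * indicator (shell j) x) = (w j :: real)"
proof -
  have "indicator (shell i) x = (if i = j then 1 else 0 :: real)" for i
    using assms(2) by (auto simp: shell_def indicator_def)
  then show ?thesis using assms by (simp add: if_distrib[of "(*) _"] cong: if_cong)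
qed

lemma shell_sum_eq_0:
  assumes "\<And>j. j \<in> J \<Longrightarrow> x \<notin> shell j"
  shows "(\<Sum>j\<in>J. w j * indicator (shell j) x) = (0 :: real)"
  using assms by (intro sum.neutral) auto

lemma in_some_shell:
  fixes x :: "'a::euclidean_space"
  assumes "exp (- real b) < norm x" "norm x < exp (- real a)"
  obtains j where "j \<in> {a..<b}" "x \<in> shell j"
proof -
  have n: "norm x > 0" using assms(1) exp_gt_zero less_trans by blast
  have lt: "real a < - ln (norm x)" "- ln (norm x) < real b"
    using assms n by (metis exp_less_cancel_iff exp_ln minus_less_iff less_minus_iff)+
  define N where "N = \<lceil>- ln (norm x)\<rceil>"
  define j where "j = nat (N - 1)"
  have c: "int a < N" "N \<le> int b"
    using lt unfolding N_def by (simp_all only: less_ceiling_iff ceiling_le_iff of_int_of_nat_eq less_imp_le)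
  then have j: "N = int j + 1" "j \<in> {a..<b}" by (auto simp: j_def)
  with n have "x \<in> shell j" by (simp add: shell_def N_def)
  with j show thesis using that by blast
qed

lemma inner_self_powr: "x \<noteq> 0 \<Longrightarrow> (x \<bullet> x) powr a = norm x powr (2 * a)"
proof -
  assume "x \<noteq> 0"
  then have "x \<bullet> x = norm x powr 2" by (simp add: power2_norm_eq_inner)
  then show ?thesis by (simp only: powr_powr)
qed

text \<open>
  The function \<open>|x|\<close> to the power \<open>- (d - 2) / 2\<close>, multiplied by a bump in \<open>log |x| / L\<close> with \<open>L = 4 n\<close>; the factor
  \<open>4\<close> lets the middle half of the support, \<open>- 7 n \<le> log |x| \<le> - 5 n\<close>, be a union of shells.
\<close>

definition almost_extremal :: "nat \<Rightarrow> real ^ 'n \<Rightarrow> real"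
  where "almost_extremal n x = log_bump (4 * real n) (- (real CARD('n) - 2) / 4) 0 0 (x \<bullet> x)"

context
  fixes n :: nat
  assumes n: "n > 0"
begin

lemma ln_inner: "(x :: real ^ 'n) \<noteq> 0 \<Longrightarrow> ln (x \<bullet> x) / (2 * (4 * real n)) = ln (norm x) / (4 * real n)"
  by (simp add: power2_norm_eq_inner[symmetric] ln_realpow)

lemma almost_extremal_eq:
  fixes x :: "real ^ 'n"
  assumes "x \<noteq> 0"
  shows "almost_extremal n x = (norm x) powr (- (real CARD('n) - 2) / 2)
      * (flat_exp 0 (ln (norm x) / (4 * real n) + 2) * flat_exp 0 (- 1 - ln (norm x) / (4 * real n)))"
proof -
  have "(x \<bullet> x) powr (- (real CARD('n) - 2) / 4) = norm x powr (2 * (- (real CARD('n) - 2) / 4))"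
    by (rule inner_self_powr[OF assms])
  also have "2 * (- (real CARD('n) - 2) / 4) = - (real CARD('n) - 2) / 2" by simp
  finally show ?thesis using assms
    unfolding almost_extremal_def log_bump_def ln_inner[OF assms] by simp
qed

lemma flat_exp_window:
  fixes x :: "real ^ 'n"
  assumes "x \<noteq> 0" "\<not> (exp (- real (8 * n)) < norm x \<and> norm x < exp (- real (4 * n)))"
  shows "ln (norm x) / (4 * real n) + 2 \<le> 0 \<or> - 1 - ln (norm x) / (4 * real n) \<le> 0"
proof -
  have "norm x > 0" using assms by simp
  then have "ln (norm x) \<le> - real (8 * n) \<or> - real (4 * n) \<le> ln (norm x)"
    using assms(2) by (metis exp_less_cancel_iff exp_ln not_less)
  then show ?thesis using n by (auto simp: field_simps)
qed

lemma almost_extremal_support: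
  fixes x :: "real ^ 'n"
  assumes "almost_extremal n x \<noteq> 0"
  shows "exp (- real (8 * n)) < norm x \<and> norm x < exp (- real (4 * n))"
proof (rule ccontr)
  assume c: "\<not> ?thesis"
  have x: "x \<noteq> 0" using assms by (auto simp: almost_extremal_def log_bump_def)
  with assms flat_exp_window[OF x c] show False
    by (auto simp: almost_extremal_eq flat_exp_def)
qed

lemma almost_extremal_smooth: "smooth (almost_extremal n :: real ^ 'n \<Rightarrow> real)"
  unfolding almost_extremal_def[abs_def]
  by (rule bump_algebra_smooth[of "4 * real n"]) (use n in \<open>auto intro: bump_algebra.bump\<close>)

text \<open>
  Adding \<open>(d - 2) / 2 u x / |x|\<^sup>2\<close> to the gradient cancels the contribution of the power of \<open>|x|\<close>. What
  remains is the derivative of the bump, which is of order \<open>1 / n\<close>.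
\<close>

lemma almost_extremal_gradient:
  fixes x :: "real ^ 'n"
  assumes x: "x \<noteq> 0"
  defines "t \<equiv> ln (norm x) / (4 * real n)"
  shows "gradient (almost_extremal n) x + ((real CARD('n) - 2) / 2 * almost_extremal n x) *\<^sub>R ((1 / (norm x)\<^sup>2) *\<^sub>R x)
    = (norm x powr (- (real CARD('n) + 2) / 2) * (flat_exp 2 (t + 2) * flat_exp 0 (- 1 - t) - flat_exp 0 (t + 2) * flat_exp 2 (- 1 - t))
        / (4 * real n)) *\<^sub>R x"
proof -
  let ?L = "4 * real n" and ?a = "- (real CARD('n) - 2) / 4"
  have L: "?L > 0" using n by simp
  define q where "q = x \<bullet> x"
  have q: "q > 0" using x by (simp add: q_def)
  have "((almost_extremal n) has_derivative (\<lambda>v. ((2 * log_bump' ?L ?a 0 0 q) *\<^sub>R x) \<bullet> v)) (at x)"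
    unfolding almost_extremal_def[abs_def] q_def by (rule log_bump_inner_deriv[OF L])
  then have grad: "gradient (almost_extremal n) x = (2 * log_bump' ?L ?a 0 0 q) *\<^sub>R x"
    by (simp add: gradient_def partial_deriv_eq[of "almost_extremal n"] vec_eq_iff del: inner_scaleR_left)
  have p: "q powr (?a - 1) = norm x powr (- (real CARD('n) + 2) / 2)"
  proof -
    have "q powr (?a - 1) = norm x powr (2 * (?a - 1))"
      unfolding q_def by (rule inner_self_powr[OF x])
    also have "2 * (?a - 1) = - (real CARD('n) + 2) / 2" by (simp add: field_simps)
    finally show ?thesis .
  qed
  have pa: "q powr ?a = q powr (?a - 1) * q" using q by (simp add: powr_diff)
  have t: "ln q / (2 * ?L) = t" unfolding t_def q_def by (rule ln_inner[OF x])
  have "2 * log_bump' ?L ?a 0 0 q + (real CARD('n) - 2) / 2 * log_bump ?L ?a 0 0 q * (1 / q)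
    = q powr (?a - 1) * (flat_exp 2 (t + 2) * flat_exp 0 (- 1 - t) - flat_exp 0 (t + 2) * flat_exp 2 (- 1 - t)) / ?L"
    using q L unfolding log_bump'_def log_bump_def t pa add_0 by (simp add: field_simps)
  then show ?thesis
    unfolding grad p[symmetric] almost_extremal_def q_def[symmetric] power2_norm_eq_inner
    by (simp add: scaleR_add_left[symmetric])
qed


text \<open>
  By the divergence identity for the origin, \<open>\<integral> |\<nabla>u|\<^sup>2 = ((d - 2) / 2)\<^sup>2 D + \<integral> |F|\<^sup>2\<close>, where \<open>F\<close> is the corrected gradient.
  On each shell the integral of \<open>|x|\<^bsup>-d\<^esup>\<close> lies between two positive constants independent of the shell.
  Counting shells, \<open>D\<close> grows at least like \<open>n\<close>, while \<open>\<integral> |F|\<^sup>2\<close> is at most of order \<open>n\<close> times \<open>1 / n\<^sup>2\<close>.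
\<close>

lemma almost_extremal_energy:
  defines "D \<equiv> integral\<^sup>L lborel (\<lambda>x::real ^ 'n. (almost_extremal n x)\<^sup>2 / (norm x)\<^sup>2)"
  shows "integrable lborel (\<lambda>x::real ^ 'n. (norm (gradient (almost_extremal n) x))\<^sup>2)"
    and "integrable lborel (\<lambda>x::real ^ 'n. (almost_extremal n x)\<^sup>2 / (norm x)\<^sup>2)"
    and "D > 0"
    and "integral\<^sup>L lborel (\<lambda>x::real ^ 'n. (norm (gradient (almost_extremal n) x))\<^sup>2)
      \<le> ((real CARD('n) - 2)\<^sup>2 / 4 + exp (16 + real CARD('n)) / (2 * (real n)\<^sup>2)) * D"
proof -
  let ?d = "real CARD('n)" and ?u = "almost_extremal n :: real ^ 'n \<Rightarrow> real"
  define \<alpha> where "\<alpha> = (?d - 2) / 2"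
  define c where "c = measure lborel (ball 0 1 :: (real ^ 'n) set)"
  have c: "c > 0" unfolding c_def by simp
  define K where "K = cball 0 (exp (- real (4 * n))) - ball (0 :: real ^ 'n) (exp (- real (8 * n)))"
  have K: "compact K" unfolding K_def by (intro compact_diff) auto
  have u0: "?u x = 0" if "x \<notin> K" for x
    by (rule ccontr) (use almost_extremal_support[of x] that in \<open>auto simp: K_def\<close>)
  have K0: "0 \<notin> K" by (simp add: K_def)
  have oK: "open (- K)" using K by (simp add: compact_imp_closed open_Compl)
  note u = almost_extremal_smooth
  have g0: "gradient ?u x = 0" if "x \<notin> K" for x
    by (rule gradient_eq_0[OF u oK]) (use that u0 in auto)
  note cont = smooth_continuous[OF u] smooth_continuous_gradient[OF u]
  show int_g: "integrable lborel (\<lambda>x. (norm (gradient ?u x))\<^sup>2)"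
    using K by (rule integrable_compact_support) (use g0 in \<open>auto intro!: continuous_intros cont\<close>)
  note id = hardy_divergence_identity[OF u K u0 K0, simplified]
  show int_D: "integrable lborel (\<lambda>x. (?u x)\<^sup>2 / (norm x)\<^sup>2)" by (rule id(2))
  have int_c: "integrable lborel (\<lambda>x. 2 * ?u x * (gradient ?u x \<bullet> x) / (norm x)\<^sup>2)" by (rule id(1))
  define F where "F x = gradient ?u x + (\<alpha> * ?u x) *\<^sub>R ((1 / (norm x)\<^sup>2) *\<^sub>R x)" for x
  have expand: "(norm (v + b *\<^sub>R w))\<^sup>2 = (norm v)\<^sup>2 + 2 * b * (v \<bullet> w) + b\<^sup>2 * (norm w)\<^sup>2"
    for v w :: "real ^ 'n" and b
    unfolding power2_norm_eq_inner
    by (simp add: inner_add_left inner_add_right inner_commute power2_eq_square)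
  have F_sq: "(norm (F x))\<^sup>2 = (norm (gradient ?u x))\<^sup>2
      + (\<alpha> * (2 * ?u x * (gradient ?u x \<bullet> x) / (norm x)\<^sup>2) + \<alpha>\<^sup>2 * ((?u x)\<^sup>2 / (norm x)\<^sup>2))" for x
  proof (cases "x = 0")
    case True
    then show ?thesis by (simp add: F_def)
  next
    case False
    have "(norm (F x))\<^sup>2 = (norm (gradient ?u x))\<^sup>2 + 2 * (\<alpha> * ?u x * (1 / (norm x)\<^sup>2)) * (gradient ?u x \<bullet> x)
        + (\<alpha> * ?u x * (1 / (norm x)\<^sup>2))\<^sup>2 * (norm x)\<^sup>2"
      unfolding F_def scaleR_scaleR by (rule expand)
    also have "(\<alpha> * ?u x * (1 / (norm x)\<^sup>2))\<^sup>2 * (norm x)\<^sup>2 = \<alpha>\<^sup>2 * ((?u x)\<^sup>2 / (norm x)\<^sup>2)"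
      using False by (simp add: power_mult_distrib power_divide field_simps power2_eq_square)
    finally show ?thesis by simp
  qed
  have int_F: "integrable lborel (\<lambda>x. (norm (F x))\<^sup>2)"
    unfolding F_sq
    by (intro Bochner_Integration.integrable_add int_g integrable_mult_right int_c int_D)
  have "(\<integral>x. (norm (F x))\<^sup>2 \<partial>lborel) = (\<integral>x. (norm (gradient ?u x))\<^sup>2 \<partial>lborel)
      + (\<alpha> * (\<integral>x. 2 * ?u x * (gradient ?u x \<bullet> x) / (norm x)\<^sup>2 \<partial>lborel) + \<alpha>\<^sup>2 * D)"
    unfolding F_sq D_def
    by (simp only: Bochner_Integration.integral_add int_g integrable_mult_right int_c int_D
        Bochner_Integration.integrable_add integral_mult_right_zero)
  also have "(\<integral>x. 2 * ?u x * (gradient ?u x \<bullet> x) / (norm x)\<^sup>2 \<partial>lborel) = - (2 * \<alpha>) * D"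
    using id(3) unfolding D_def \<alpha>_def by (simp add: field_simps)
  finally have energy: "(\<integral>x. (norm (gradient ?u x))\<^sup>2 \<partial>lborel) = \<alpha>\<^sup>2 * D + (\<integral>x. (norm (F x))\<^sup>2 \<partial>lborel)"
    by (simp add: power2_eq_square algebra_simps)
  have powr_up: "norm x powr (- ?d) \<le> exp ((real j + 1) * ?d)" and powr_low: "exp (real j * ?d) \<le> norm x powr (- ?d)"
    if "x \<in> shell j" for x :: "real ^ 'n" and j
  proof -
    have s: "exp (- (real j + 1)) \<le> norm x" "norm x < exp (- real j)" using that by (auto simp: shell_iff)
    have "norm x powr (- ?d) \<le> exp (- (real j + 1)) powr (- ?d)"
      by (intro powr_mono2' s) auto
    then show "norm x powr (- ?d) \<le> exp ((real j + 1) * ?d)" by (simp add: exp_powr_real algebra_simps)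
    have "exp (- real j) powr (- ?d) \<le> norm x powr (- ?d)"
      by (intro powr_mono2') (use s less_le_trans[OF exp_gt_zero s(1)] in auto)
    then show "exp (real j * ?d) \<le> norm x powr (- ?d)" by (simp add: exp_powr_real)
  qed
  \<comment> \<open>The shells where the bump may be nonzero are those with \<open>4 n \<le> j < 8 n\<close>; its derivative is at most \<open>2\<close>.\<close>
  have shell_up: "exp ((real j + 1) * ?d) * measure lborel (shell j :: (real ^ 'n) set) = c * (exp ?d - 1)"
    and shell_low: "exp (real j * ?d) * measure lborel (shell j :: (real ^ 'n) set) = c * (1 - exp (- ?d))" for j
  proof -
    have e: "exp ((real j + 1) * ?d) = exp (real j * ?d) * exp ?d"
      by (simp add: exp_add[symmetric] distrib_right)
    have m: "measure lborel (shell j :: (real ^ 'n) set) = c * (inverse (exp (real j * ?d)) - inverse (exp (real j * ?d) * exp ?d))"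
      unfolding measure_shell c_def exp_minus e[symmetric] by simp
    show "exp ((real j + 1) * ?d) * measure lborel (shell j :: (real ^ 'n) set) = c * (exp ?d - 1)"
      "exp (real j * ?d) * measure lborel (shell j :: (real ^ 'n) set) = c * (1 - exp (- ?d))"
      unfolding m e exp_minus by (simp_all add: field_simps)
  qed
  have "(\<integral>x. (norm (F x))\<^sup>2 \<partial>lborel)
    \<le> integral\<^sup>L lborel (\<lambda>x::real ^ 'n. \<Sum>j\<in>{4 * n..<8 * n}. (exp ((real j + 1) * ?d) / (4 * (real n)\<^sup>2)) * indicator (shell j) x)"
  proof (rule integral_mono[OF int_F integral_weighted_shells(1)])
    fix x :: "real ^ 'n"
    let ?S = "\<Sum>j\<in>{4 * n..<8 * n}. (exp ((real j + 1) * ?d) / (4 * (real n)\<^sup>2)) * indicator (shell j) x"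
    show "(norm (F x))\<^sup>2 \<le> ?S"
    proof (cases "x = 0")
      case True
      then have "F x = 0" using g0[OF K0] by (simp add: F_def)
      then show ?thesis by (auto intro!: sum_nonneg)
    next
      case False
      define t where "t = ln (norm x) / (4 * real n)"
      define B where "B = flat_exp 2 (t + 2) * flat_exp 0 (- 1 - t) - flat_exp 0 (t + 2) * flat_exp 2 (- 1 - t)"
      have F: "F x = (norm x powr (- (?d + 2) / 2) * B / (4 * real n)) *\<^sub>R x"
        unfolding F_def \<alpha>_def B_def t_def by (rule almost_extremal_gradient[OF False])
      have "(norm x powr (- (?d + 2) / 2))\<^sup>2 = norm x powr (- (?d + 2))"
        by (simp add: power2_eq_square powr_add[symmetric] del: minus_add_distrib)
      also have "\<dots> * (norm x)\<^sup>2 = norm x powr (- (?d + 2) + 2)"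
        unfolding powr_add using False by simp
      finally have p: "(norm x powr (- (?d + 2) / 2))\<^sup>2 * (norm x)\<^sup>2 = norm x powr (- ?d)" by simp
      have Fx: "(norm (F x))\<^sup>2 = norm x powr (- ?d) * (B\<^sup>2 / (16 * (real n)\<^sup>2))"
        unfolding F p[symmetric] by (simp add: power_mult_distrib power_divide)
      show ?thesis
      proof (cases "exp (- real (8 * n)) < norm x \<and> norm x < exp (- real (4 * n))")
        case True
        then obtain j where j: "j \<in> {4 * n..<8 * n}" "x \<in> shell j"
          using in_some_shell[of "8 * n" x "4 * n"] by blast
        have "flat_exp 2 (t + 2) * flat_exp 0 (- 1 - t) \<le> 2 * 1" "flat_exp 0 (t + 2) * flat_exp 2 (- 1 - t) \<le> 1 * 2"
          by (intro mult_mono flat_exp_2_le_2 flat_exp_0_le_1 flat_exp_nonneg; simp)+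
        moreover have "0 \<le> flat_exp 2 (t + 2) * flat_exp 0 (- 1 - t)" "0 \<le> flat_exp 0 (t + 2) * flat_exp 2 (- 1 - t)"
          by (intro mult_nonneg_nonneg flat_exp_nonneg)+
        ultimately have "\<bar>B\<bar> \<le> 2" unfolding B_def by linarith
        then have "B\<^sup>2 \<le> 4" using abs_le_square_iff[of B 2] by simp
        then have "B\<^sup>2 / (16 * (real n)\<^sup>2) \<le> 1 / (4 * (real n)\<^sup>2)" using n by (simp add: field_simps)
        then have "(norm (F x))\<^sup>2 \<le> exp ((real j + 1) * ?d) * (1 / (4 * (real n)\<^sup>2))"
          unfolding Fx by (intro mult_mono powr_up j) auto
        also have "\<dots> = ?S" using j by (subst shell_sum_eq[of _ x j]) auto
        finally show ?thesis .
      next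
        case out: False
        have "B = 0" using flat_exp_window[OF False out] unfolding B_def t_def by (auto simp: flat_exp_def)
        then show ?thesis unfolding Fx by (auto intro!: sum_nonneg)
      qed
    qed
  qed simp
  also have "\<dots> = (\<Sum>j\<in>{4 * n..<8 * n}. c * (exp ?d - 1) / (4 * (real n)\<^sup>2))"
    unfolding integral_weighted_shells(2)[OF finite_atLeastLessThan]
    by (intro sum.cong refl) (use shell_up in \<open>simp add: field_simps\<close>)
  also have "\<dots> = c * (exp ?d - 1) / real n" using n by (simp add: power2_eq_square)
  finally have E: "(\<integral>x. (norm (F x))\<^sup>2 \<partial>lborel) \<le> c * (exp ?d - 1) / real n" .
  \<comment> \<open>On the shells with \<open>5 n \<le> j < 7 n\<close> both factors of the bump are at least \<open>e\<^bsup>-4\<^esup>\<close>.\<close>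
  have "2 * real n * (exp (- 16) * c * (1 - exp (- ?d)))
     = (\<Sum>j\<in>{5 * n..<7 * n}. exp (- 16) * c * (1 - exp (- ?d)))" by simp
  also have "\<dots> = integral\<^sup>L lborel (\<lambda>x::real ^ 'n. \<Sum>j\<in>{5 * n..<7 * n}. (exp (real j * ?d) * exp (- 16)) * indicator (shell j) x)"
    unfolding integral_weighted_shells(2)[OF finite_atLeastLessThan]
    by (intro sum.cong refl) (use shell_low in \<open>simp add: mult_ac\<close>)
  also have "\<dots> \<le> D"
    unfolding D_def
  proof (rule integral_mono[OF integral_weighted_shells(1) int_D])
    fix x :: "real ^ 'n"
    let ?S = "\<Sum>j\<in>{5 * n..<7 * n}. (exp (real j * ?d) * exp (- 16)) * indicator (shell j) x"
    show "?S \<le> (?u x)\<^sup>2 / (norm x)\<^sup>2"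
    proof (cases "\<exists>j\<in>{5 * n..<7 * n}. x \<in> shell j")
      case True
      then obtain j where j: "j \<in> {5 * n..<7 * n}" "x \<in> shell j" by blast
      define t where "t = ln (norm x) / (4 * real n)"
      have x: "x \<noteq> 0" using j by (simp add: shell_def)
      have "exp (- (real j + 1)) \<le> norm x" "norm x < exp (- real j)" using j by (auto simp: shell_iff)
      then have ln: "- (real j + 1) \<le> ln (norm x)" "ln (norm x) < - real j"
        using x by (metis exp_le_cancel_iff exp_less_cancel_iff exp_ln zero_less_norm_iff)+
      have "real j + 1 \<le> 7 * real n" "5 * real n \<le> real j" using j(1) by auto
      with ln have "- 7 * real n \<le> ln (norm x)" "ln (norm x) \<le> - 5 * real n" by linarith+
      then have "1 / 4 \<le> t + 2" "1 / 4 \<le> - 1 - t" using n by (simp_all add: t_def field_simps)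
      then have "exp (- 4) * exp (- 4) \<le> flat_exp 0 (t + 2) * flat_exp 0 (- 1 - t)"
        by (intro mult_mono flat_exp_0_lower flat_exp_nonneg) auto
      then have "(exp (- 4) * exp (- 4))\<^sup>2 \<le> (flat_exp 0 (t + 2) * flat_exp 0 (- 1 - t))\<^sup>2"
        by (rule power_mono) simp
      then have b: "exp (- 16) \<le> (flat_exp 0 (t + 2) * flat_exp 0 (- 1 - t))\<^sup>2"
        by (simp add: exp_add[symmetric] power2_eq_square)
      have "(norm x powr (- (?d - 2) / 2))\<^sup>2 = norm x powr (- (?d - 2))"
        by (simp add: power2_eq_square powr_add[symmetric] del: minus_diff_eq)
      also have "\<dots> / (norm x)\<^sup>2 = norm x powr (- (?d - 2) - 2)"
        unfolding powr_diff[of _ "- (?d - 2)" 2] using x by simp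
      finally have p: "(norm x powr (- (?d - 2) / 2))\<^sup>2 / (norm x)\<^sup>2 = norm x powr (- ?d)" by simp
      have "?S = exp (real j * ?d) * exp (- 16)" using j by (subst shell_sum_eq[of _ x j]) auto
      also have "\<dots> \<le> norm x powr (- ?d) * (flat_exp 0 (t + 2) * flat_exp 0 (- 1 - t))\<^sup>2"
        by (intro mult_mono powr_low j b) auto
      also have "\<dots> = (?u x)\<^sup>2 / (norm x)\<^sup>2"
        unfolding almost_extremal_eq[OF x] t_def[symmetric] p[symmetric] by (simp add: power_mult_distrib)
      finally show ?thesis .
    next
      case False
      then have "?S = 0" by (intro shell_sum_eq_0) auto
      then show ?thesis by simp
    qed
  qed simp
  finally have D: "2 * real n * (exp (- 16) * c * (1 - exp (- ?d))) \<le> D" .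
  moreover have "2 * real n * (exp (- 16) * c * (1 - exp (- ?d))) > 0"
    using n c by (intro mult_pos_pos) auto
  ultimately show "D > 0" by linarith
  have "c * (exp ?d - 1) / real n = exp (16 + ?d) / (2 * (real n)\<^sup>2) * (2 * real n * (exp (- 16) * c * (1 - exp (- ?d))))"
    using n by (simp add: exp_add exp_minus field_simps power2_eq_square)
  also have "\<dots> \<le> exp (16 + ?d) / (2 * (real n)\<^sup>2) * D"
    by (intro mult_left_mono D) auto
  finally show "(\<integral>x. (norm (gradient ?u x))\<^sup>2 \<partial>lborel)
      \<le> ((?d - 2)\<^sup>2 / 4 + exp (16 + ?d) / (2 * (real n)\<^sup>2)) * D"
    using E unfolding energy \<alpha>_def by (simp add: power_divide distrib_right)
qed

end

section \<open>The Hardy constant of the cylinder\<close>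

lemma ball_subset_interior_cylinder: "ball 0 R \<subseteq> interior (cylinder R)"
proof (rule interior_maximal)
  show "ball 0 R \<subseteq> (cylinder R :: (real ^ 'n) set)"
  proof
    fix x :: "real ^ 'n" assume "x \<in> ball 0 R"
    moreover have "(0 :: real ^ 'n) \<in> diagonal" by (auto simp: diagonal_def vec_eq_iff)
    then have "infdist x diagonal \<le> dist x 0" by (rule infdist_le)
    ultimately show "x \<in> cylinder R" by (simp add: cylinder_def)
  qed
qed simp

lemma almost_extremal_test_function:
  assumes n: "n > 0" and small: "exp (- real (4 * n)) < R" "exp (- real (4 * n)) < h"
  shows "almost_extremal n \<in> test_functions (interior (cylinder R) - poles h :: (real ^ 'n) set) - {\<lambda>x. 0}"
proof -
  let ?u = "almost_extremal n :: real ^ 'n \<Rightarrow> real"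
  define K where "K = cball 0 (exp (- real (4 * n))) - ball (0 :: real ^ 'n) (exp (- real (8 * n)))"
  have K: "compact K" unfolding K_def by (intro compact_diff) auto
  have "{x. ?u x \<noteq> 0} \<subseteq> K"
    using almost_extremal_support[OF n] by (force simp: K_def)
  then have cl: "closure {x. ?u x \<noteq> 0} \<subseteq> K"
    using K by (simp add: closure_minimal compact_imp_closed)
  moreover have "K \<subseteq> interior (cylinder R) - poles h"
  proof
    fix x assume x: "x \<in> K"
    then have nx: "exp (- real (8 * n)) \<le> norm x" "norm x \<le> exp (- real (4 * n))" by (auto simp: K_def)
    then have "x \<in> ball 0 R" using small by simp
    then have "x \<in> interior (cylinder R)" using ball_subset_interior_cylinder by blast
    moreover have "x \<noteq> pole h k" for k
    proof
      assume xk: "x = pole h k"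
      have "\<bar>of_int k * h\<bar> = \<bar>x $ i\<bar>" for i by (simp add: xk pole_def)
      also have "\<bar>x $ i\<bar> \<le> norm x" for i by (rule component_le_norm_cart)
      also have "norm x < h" using nx small by simp
      finally have "\<bar>of_int k * h\<bar> < h" .
      moreover have "h > 0" using exp_gt_zero small(2) by (rule less_trans)
      ultimately have "\<bar>real_of_int k\<bar> < 1" by (simp add: abs_mult)
      then have "k = 0" by linarith
      then have "x = 0" by (simp add: xk pole_def vec_eq_iff)
      then show False using nx(1) by simp
    qed
    ultimately show "x \<in> interior (cylinder R) - poles h" by (auto simp: poles_def)
  qed
  ultimately have sub: "closure {x. ?u x \<noteq> 0} \<subseteq> interior (cylinder R) - poles h" by blast
  have "compact (closure {x. ?u x \<noteq> 0})"
    using cl K by (metis closed_closure compact_Int_closed inf.absorb_iff2)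
  moreover have "?u \<noteq> (\<lambda>x. 0)"
  proof
    assume "?u = (\<lambda>x. 0)"
    then show False using almost_extremal_energy(3)[OF n, where 'n = 'n] by simp
  qed
  ultimately show ?thesis using sub almost_extremal_smooth[OF n] by (simp add: test_functions_def)
qed

lemma hardy_const_bounds:
  assumes h0: "h > 0" and h: "real CARD('n) * h = 1" and R: "R > 0"
  shows "(real CARD('n) - 2)\<^sup>2 / (4 * pi * R * sqrt (real CARD('n)) * coth (pi * R * sqrt (real CARD('n))))
      \<le> hardy_const h (cylinder R :: (real ^ 'n) set)"
    and "hardy_const h (cylinder R :: (real ^ 'n) set) \<le> (real CARD('n) - 2)\<^sup>2 / 4"
proof -
  let ?d = "real CARD('n)"
  let ?C = "cylinder R :: (real ^ 'n) set"
  let ?U = "test_functions (interior ?C - poles h) - {\<lambda>x. 0}"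
  let ?Q = "\<lambda>u. (LINT x:?C|lborel. (norm (gradient u x))\<^sup>2) / (LINT x:?C|lborel. potential h x * (u x)\<^sup>2)"
  have "((\<lambda>n::nat. exp (- real (4 * n))) \<longlongrightarrow> 0) sequentially" by real_asymp
  from order_tendstoD(2)[OF this R] order_tendstoD(2)[OF this h0]
  have ev: "\<forall>\<^sub>F n in sequentially. almost_extremal n \<in> ?U \<and> n > 0"
    using eventually_gt_at_top[of "0::nat"]
    by eventually_elim (use almost_extremal_test_function in blast)
  then have ne: "?U \<noteq> {}" by (auto dest!: eventually_happens)
  have Q_nonneg: "?Q u \<ge> 0" for u
    unfolding set_lebesgue_integral_def
    by (intro divide_nonneg_nonneg Bochner_Integration.integral_nonneg) (auto simp: potential_nonneg)
  show "(?d - 2)\<^sup>2 / (4 * pi * R * sqrt ?d * coth (pi * R * sqrt ?d)) \<le> hardy_const h ?C"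
    unfolding hardy_const_def
  proof (rule cINF_greatest[OF ne])
    fix u assume u: "u \<in> ?U"
    note t = test_function_facts[OF h u]
    have "(?d - 2)\<^sup>2 / (4 * (pi * R * sqrt ?d * coth (pi * R * sqrt ?d))) * (\<integral>x. potential h x * (u x)\<^sup>2 \<partial>lborel)
      \<le> (\<integral>x. (norm (gradient u x))\<^sup>2 \<partial>lborel)"
      by (rule hardy_inequality_cylinder(3)[OF h R t(1-5)])
    then show "(?d - 2)\<^sup>2 / (4 * pi * R * sqrt ?d * coth (pi * R * sqrt ?d)) \<le> ?Q u"
      unfolding t(6,7) using t(8)[OF R] by (simp add: pos_le_divide_eq mult.assoc)
  qed
  have le: "hardy_const h ?C \<le> (?d - 2)\<^sup>2 / 4 + exp (16 + ?d) / (2 * (real n)\<^sup>2)"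
    if n: "n > 0" and u: "almost_extremal n \<in> ?U" for n
  proof -
    let ?u = "almost_extremal n :: real ^ 'n \<Rightarrow> real"
    let ?c = "(?d - 2)\<^sup>2 / 4 + exp (16 + ?d) / (2 * (real n)\<^sup>2)"
    let ?D = "integral\<^sup>L lborel (\<lambda>x. (?u x)\<^sup>2 / (norm x)\<^sup>2)"
    note t = test_function_facts[OF h u] and e = almost_extremal_energy[OF n, where 'n = 'n]
    have int_V: "integrable lborel (\<lambda>x. potential h x * (?u x)\<^sup>2)"
      by (rule hardy_inequality_cylinder(2)[OF h R t(1-5)])
    have "?D \<le> (\<integral>x. potential h x * (?u x)\<^sup>2 \<partial>lborel)"
    proof (rule integral_mono[OF e(2) int_V])
      fix x
      show "(?u x)\<^sup>2 / (norm x)\<^sup>2 \<le> potential h x * (?u x)\<^sup>2"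
      proof (cases "?u x = 0")
        case False
        then have "x \<notin> poles h" using t(3,4) by blast
        from potential_ge_inverse_square[OF h this, of 0]
        have "1 / (norm x)\<^sup>2 \<le> potential h x" by (simp add: pole_eq)
        from mult_right_mono[OF this, of "(?u x)\<^sup>2"] show ?thesis by simp
      qed simp
    qed
    then have "?c * ?D \<le> ?c * (\<integral>x. potential h x * (?u x)\<^sup>2 \<partial>lborel)" by (intro mult_left_mono) auto
    with e(4) have "?Q ?u \<le> ?c"
      unfolding t(6,7) using t(8)[OF R] by (simp add: pos_divide_le_eq)
    moreover have "hardy_const h ?C \<le> ?Q ?u"
      unfolding hardy_const_def by (intro cINF_lower u bdd_belowI2[of _ 0] Q_nonneg)
    ultimately show ?thesis by simp
  qed
  show "hardy_const h ?C \<le> (?d - 2)\<^sup>2 / 4"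
  proof (rule tendsto_lowerbound)
    show "((\<lambda>n. (?d - 2)\<^sup>2 / 4 + exp (16 + ?d) / (2 * (real n)\<^sup>2)) \<longlongrightarrow> (?d - 2)\<^sup>2 / 4) sequentially"
      by real_asymp
    show "\<forall>\<^sub>F n in sequentially. hardy_const h ?C \<le> (?d - 2)\<^sup>2 / 4 + exp (16 + ?d) / (2 * (real n)\<^sup>2)"
      using ev by eventually_elim (use le in blast)
  qed simp
qed

theorem theorem3p2:
  fixes h :: real
  assumes "h > 0" and "real CARD('n::finite) * h = 1"
  shows "(\<forall>R>0.
            (real CARD('n) - 2)\<^sup>2 / (4 * pi * R * sqrt (real CARD('n)) * coth (pi * R * sqrt (real CARD('n))))
              \<le> hardy_const h (cylinder R :: (real ^ 'n) set) \<and>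
            hardy_const h (cylinder R :: (real ^ 'n) set) \<le> (real CARD('n) - 2)\<^sup>2 / 4) \<and>
         ((\<lambda>R. hardy_const h (cylinder R :: (real ^ 'n) set))
            \<longlongrightarrow> (real CARD('n) - 2)\<^sup>2 / 4) (at_right 0)"
proof (intro conjI allI impI)
  show "(real CARD('n) - 2)\<^sup>2 / (4 * pi * R * sqrt (real CARD('n)) * coth (pi * R * sqrt (real CARD('n))))
      \<le> hardy_const h (cylinder R :: (real ^ 'n) set)"
    and "hardy_const h (cylinder R :: (real ^ 'n) set) \<le> (real CARD('n) - 2)\<^sup>2 / 4" if "R > 0" for R
    using hardy_const_bounds[OF assms that] .
  define s where "s = sqrt (real CARD('n))"
  have s: "s > 0" by (simp add: s_def)
  show "((\<lambda>R. hardy_const h (cylinder R :: (real ^ 'n) set)) \<longlongrightarrow> (real CARD('n) - 2)\<^sup>2 / 4) (at_right 0)"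
  proof (rule tendsto_sandwich)
    have "((\<lambda>R. 4 * pi * R * s * coth (pi * R * s)) \<longlongrightarrow> 4) (at_right 0)"
      unfolding coth_def using s by real_asymp (simp add: field_simps)
    then have "((\<lambda>R. (real CARD('n) - 2)\<^sup>2 / (4 * pi * R * s * coth (pi * R * s)))
        \<longlongrightarrow> (real CARD('n) - 2)\<^sup>2 / 4) (at_right 0)"
      by (intro tendsto_intros) auto
    then show "((\<lambda>R. (real CARD('n) - 2)\<^sup>2 / (4 * pi * R * sqrt (real CARD('n)) * coth (pi * R * sqrt (real CARD('n)))))
        \<longlongrightarrow> (real CARD('n) - 2)\<^sup>2 / 4) (at_right 0)"
      unfolding s_def .
    show "((\<lambda>R. (real CARD('n) - 2)\<^sup>2 / 4) \<longlongrightarrow> (real CARD('n) - 2)\<^sup>2 / 4) (at_right (0::real))"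
      by (rule tendsto_const)
  qed (use hardy_const_bounds[OF assms] in \<open>auto simp: eventually_at_filter\<close>)
qed

end
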